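(* (1) If $2^{\aleph_0} < \aleph_\omega$, then there is a saturated MAD family $\mathcal{A} \subseteq [\omega]^{\aleph_0}$. (2) Moreover, if $2^{\aleph_0} < \aleph_\omega$, then for any dense $J_* \subseteq [\omega]^{\aleph_0}$ there is a saturated MAD family $\mathcal{A}$ with $\mathcal{A} \subseteq J_*$.
   Context: $[\omega]^{\aleph_0}$ is the set of infinite subsets of $\omega$. For $A,B\subseteq\omega$, $A \subseteq^* B$ means that $A \setminus B$ is finite; we then say that $B$ almost contains $A$. A family $\mathcal{A} \subseteq [\omega]^{\aleph_0}$ is AD if it is infinite and any two distinct members have finite intersection. It is MAD if it is AD and $\subseteq$-maximal among AD families $\subseteq [\omega]^{\aleph_0}$. For $\mathcal{A} \subseteq [\omega]^{\aleph_0}$, $\mathrm{id}_{\mathcal{A}}$ is the ideal of subsets of $\omega$ generated by $\mathcal{A}$ together with the finite subsets of $\omega$, and $\mathrm{id}^+_{\mathcal{A}} = [\omega]^{\aleph_0} \setminus \mathrm{id}_{\mathcal{A}}$. A MAD family $\mathcal{A}$ is saturated if every $B \in \mathrm{id}^+_{\mathcal{A}}$ almost contains some member of $\mathcal{A}$. $J \subseteq [\omega]^{\aleph_0}$ is dense if for every $B \in [\omega]^{\aleph_0}$ there is $A \in J$ with $A \subseteq B$. *)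

theory Defs
  imports Complex_Main
begin

unbundle cardinal_syntax

section \<open>Cardinals below aleph-omega\<close>

text \<open>
  Cardinals are represented, as in the library, by cardinal orders, up to \<open>=o\<close>.  Since
  \<^const>\<open>cardSuc\<close> changes the underlying type, ``\<open>k\<close> is the \<open>n\<close>-th aleph'' is a predicate
  all of whose witnesses live on the type of \<open>k\<close>.
\<close>

primrec is_aleph :: "nat \<Rightarrow> 'a rel \<Rightarrow> bool" where
  "is_aleph 0 = (\<lambda>k. k =o natLeq)"
| "is_aleph (Suc n) = (\<lambda>k. \<exists>l. is_aleph n l \<and> k =o cardSuc l)"

text \<open>
  Higher-order logic does not provide a type of cardinality \<open>\<aleph>\<^sub>\<omega>\<close>; but
  \<open>\<aleph>\<^sub>\<omega>\<close> is the supremum of the \<open>\<aleph>\<^sub>n\<close>, so that \<open>\<kappa> < \<aleph>\<^sub>\<omega>\<close> means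
  \<open>\<kappa> < \<aleph>\<^sub>n\<close> for some \<open>n\<close>.  The type \<open>('a + nat) set\<close> is large enough to hold the least
  such \<open>\<aleph>\<^sub>n\<close> for a cardinal \<open>\<kappa>\<close> on \<open>'a\<close>; see \<open>less_aleph_omegaI\<close> below.
\<close>

definition less_aleph_omega :: "'a rel \<Rightarrow> bool" where
  "less_aleph_omega r \<longleftrightarrow> (\<exists>n. \<exists>k :: ('a + nat) set rel. is_aleph n k \<and> r <o k)"

lemma is_aleph_Card_order: "is_aleph n (k :: 'a rel) \<Longrightarrow> Card_order k"
proof (induction n arbitrary: k)
  case 0
  then show ?case using Card_order_ordIso[OF natLeq_Card_order] by simp
next
  case (Suc n)
  then obtain l :: "'a rel" where "is_aleph n l" "k =o cardSuc l" by auto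
  then show ?case using Card_order_ordIso[OF cardSuc_Card_order] Suc.IH by blast
qed

lemma is_aleph_unique:
  fixes k :: "'a rel" and l :: "'b rel"
  assumes "is_aleph n k" "is_aleph n l"
  shows "k =o l"
  using assms
proof (induction n arbitrary: k l)
  case 0
  then have "k =o natLeq" "l =o natLeq" by simp_all
  then show ?case by (rule ordIso_transitive[OF _ ordIso_symmetric])
next
  case (Suc n)
  then obtain k' :: "'a rel" and l' :: "'b rel"
    where *: "is_aleph n k'" "k =o cardSuc k'" "is_aleph n l'" "l =o cardSuc l'"
    by auto
  then have "k' =o l'" using Suc.IH by simp
  then have "cardSuc k' =o cardSuc l'"
    using * by (simp add: cardSuc_invar_ordIso is_aleph_Card_order)
  then show ?case
    by (rule ordIso_transitive[OF ordIso_transitive[OF *(2)] ordIso_symmetric[OF *(4)]])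
qed

lemma is_aleph_ordIso:
  fixes k k' :: "'a rel"
  assumes "is_aleph n k" "k' =o k"
  shows "is_aleph n k'"
proof (cases n)
  case 0
  then show ?thesis using assms by (simp add: ordIso_transitive[OF assms(2)])
next
  case (Suc m)
  then obtain l :: "'a rel" where "is_aleph m l" "k =o cardSuc l" using assms(1) by auto
  then show ?thesis using Suc ordIso_transitive[OF assms(2) \<open>k =o cardSuc l\<close>] by auto
qed

lemma ordLeq_UNIV_copy:
  fixes k :: "'a rel"
  assumes "Card_order k" "k \<le>o |UNIV :: 'b set|"
  obtains l :: "'b rel" where "l =o k"
proof -
  note Fk = card_of_Field_ordIso[OF assms(1)]
  have "|Field k| \<le>o |UNIV :: 'b set|"
    by (rule ordIso_ordLeq_trans[OF Fk assms(2)])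
  then obtain f :: "'a \<Rightarrow> 'b" where "inj_on f (Field k)"
    unfolding card_of_ordLeq[symmetric] by blast
  then have "|Field k| =o |f ` Field k|"
    using inj_on_imp_bij_betw card_of_ordIsoI by blast
  then have "|f ` Field k| =o k"
    by (rule ordIso_transitive[OF ordIso_symmetric Fk])
  then show thesis by (rule that)
qed

lemma is_aleph_transfer:
  fixes k :: "'a rel"
  assumes "is_aleph n k" "k \<le>o |UNIV :: 'b set|"
  shows "\<exists>l :: 'b rel. is_aleph n l"
  using assms
proof (induction n arbitrary: k)
  case 0
  obtain l :: "'b rel" where "l =o k"
    using ordLeq_UNIV_copy[OF is_aleph_Card_order[OF 0(1)] 0(2)] .
  moreover have "k =o natLeq" using 0 by simp
  ultimately have "l =o natLeq" by (rule ordIso_transitive)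
  then show ?case by auto
next
  case (Suc n)
  then obtain k' :: "'a rel" where k': "is_aleph n k'" "k =o cardSuc k'" by auto
  have "k' <o cardSuc k'" by (rule cardSuc_greater[OF is_aleph_Card_order[OF k'(1)]])
  also have "cardSuc k' =o k" by (rule ordIso_symmetric[OF k'(2)])
  also note Suc.prems(2)
  finally have "k' \<le>o |UNIV :: 'b set|" by (rule ordLess_imp_ordLeq)
  then obtain l' :: "'b rel" where l': "is_aleph n l'" using Suc.IH[OF k'(1)] by blast
  obtain l :: "'b rel" where lk: "l =o k"
    using ordLeq_UNIV_copy[OF is_aleph_Card_order[OF Suc.prems(1)] Suc.prems(2)] .
  have "cardSuc k' =o cardSuc l'"
    using is_aleph_unique[OF k'(1) l'] k' l'
    by (simp add: cardSuc_invar_ordIso is_aleph_Card_order)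
  then have "l =o cardSuc l'"
    by (rule ordIso_transitive[OF ordIso_transitive[OF lk k'(2)]])
  then show ?case using l' by auto
qed

lemma less_aleph_omegaI:
  fixes r :: "'a rel" and k :: "'b rel"
  assumes "Card_order r" "is_aleph n k" "r <o k"
  shows "less_aleph_omega r"
proof -
  have ex: "\<exists>n. \<exists>k :: 'b rel. is_aleph n k \<and> r <o k" using assms(2,3) by blast
  define m where "m = (LEAST n. \<exists>k :: 'b rel. is_aleph n k \<and> r <o k)"
  obtain j :: "'b rel" where j: "is_aleph m j" "r <o j"
    using LeastI_ex[OF ex] unfolding m_def by blast
  have "j \<le>o |UNIV :: ('a + nat) set set|"
  proof (cases m)
    case 0
    then have "j =o natLeq" using j(1) by simp
    then have "j =o |UNIV :: nat set|"
      by (rule ordIso_transitive[OF _ ordIso_symmetric[OF card_of_nat]])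
    moreover have "|UNIV :: nat set| \<le>o |UNIV :: ('a + nat) set set|"
      by (rule card_of_ordLeqI[of "\<lambda>n. {Inr n}"]) (simp_all add: inj_on_def)
    ultimately show ?thesis by (rule ordIso_ordLeq_trans)
  next
    case (Suc p)
    then obtain i :: "'b rel" where i: "is_aleph p i" "j =o cardSuc i" using j by auto
    have "p < m" using Suc by simp
    then have "\<not> (\<exists>k :: 'b rel. is_aleph p k \<and> r <o k)"
      unfolding m_def by (rule not_less_Least)
    then have "\<not> r <o i" using i(1) by blast
    then have "i \<le>o r"
      using ordLess_or_ordLeq[of r i] assms(1) is_aleph_Card_order[OF i(1)]
      unfolding card_order_on_def by blast
    also have "r =o |Field r|" by (rule ordIso_symmetric[OF card_of_Field_ordIso[OF assms(1)]])
    also have "|Field r| \<le>o |UNIV :: ('a + nat) set|"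
      by (rule card_of_ordLeqI[of Inl]) auto
    also have "|UNIV :: ('a + nat) set| <o |UNIV :: ('a + nat) set set|"
      using card_of_Pow[of "UNIV :: ('a + nat) set"] by simp
    finally have "cardSuc i \<le>o |UNIV :: ('a + nat) set set|"
      by (rule cardSuc_least[OF is_aleph_Card_order[OF i(1)] card_of_Card_order])
    then show ?thesis by (rule ordIso_ordLeq_trans[OF i(2)])
  qed
  then obtain l :: "('a + nat) set rel" where l: "is_aleph m l"
    using is_aleph_transfer[OF j(1)] by blast
  have "r <o l" by (rule ordLess_ordIso_trans[OF j(2) is_aleph_unique[OF j(1) l]])
  then show ?thesis using l unfolding less_aleph_omega_def by blast
qed


section \<open>Families of infinite subsets of \<open>\<omega>\<close>\<close>

definition inf_sets :: "nat set set" where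
  "inf_sets = {B. infinite B}"

definition almost_subset :: "nat set \<Rightarrow> nat set \<Rightarrow> bool"  (infix \<open>\<subseteq>*\<close> 50) where
  "A \<subseteq>* B \<longleftrightarrow> finite (A - B)"

definition AD :: "nat set set \<Rightarrow> bool" where
  "AD \<A> \<longleftrightarrow> \<A> \<subseteq> inf_sets \<and> infinite \<A> \<and> pairwise (\<lambda>A B. finite (A \<inter> B)) \<A>"

definition MAD :: "nat set set \<Rightarrow> bool" where
  "MAD \<A> \<longleftrightarrow> AD \<A> \<and> (\<forall>\<B>. AD \<B> \<and> \<A> \<subseteq> \<B> \<longrightarrow> \<B> = \<A>)"

definition ideal_of_sets :: "nat set set \<Rightarrow> bool" where
  "ideal_of_sets I \<longleftrightarrow>
    {} \<in> I \<and> (\<forall>A\<in>I. \<forall>B\<in>I. A \<union> B \<in> I) \<and> (\<forall>A\<in>I. \<forall>B. B \<subseteq> A \<longrightarrow> B \<in> I)"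

definition id_gen :: "nat set set \<Rightarrow> nat set set" where
  "id_gen \<A> = ideal_of_sets hull (\<A> \<union> {F. finite F})"

definition id_plus :: "nat set set \<Rightarrow> nat set set" where
  "id_plus \<A> = inf_sets - id_gen \<A>"

definition saturated_MAD :: "nat set set \<Rightarrow> bool" where
  "saturated_MAD \<A> \<longleftrightarrow> MAD \<A> \<and> (\<forall>B\<in>id_plus \<A>. \<exists>A\<in>\<A>. A \<subseteq>* B)"

definition dense_family :: "nat set set \<Rightarrow> bool" where
  "dense_family J \<longleftrightarrow> J \<subseteq> inf_sets \<and> (\<forall>B\<in>inf_sets. \<exists>A\<in>J. A \<subseteq> B)"

end

theory Submission
  imports Defs "HOL-Library.Countable_Set"
begin

text \<open>
  Write \<open>c\<close> for the continuum and \<open>b\<close> for the bounding number.  A set is positive for an almost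
  disjoint family if no finite subfamily almost covers it.  The family is built by recursion over
  all subsets \<open>B\<close> of \<open>\<omega>\<close> in order type \<open>c\<close>: if \<open>B\<close> is still positive when its turn comes, a subset
  of \<open>B\<close> from the dense family is added.  This makes the result saturated, provided that every
  positive \<open>B\<close> has an infinite subset almost disjoint from all sets chosen so far.  The whole
  difficulty is to keep the partial families that good.

  To this end each chosen set \<open>a\<close> is tagged with a node of a tree.  A node consists of a level \<open>\<xi>\<close>
  from a well-order of size \<open>c\<close> and of sets \<open>Y \<beta>\<close> of discarded points, one for each level
  \<open>\<beta>\<close> below \<open>\<xi>\<close>; and \<open>a\<close> is almost disjoint from all of them.  At each level \<open>\<alpha>\<close> the points of
  \<open>\<omega>\<close> get finitely many colors, which depend on \<open>\<alpha>\<close> and on the \<open>Y \<beta>\<close> below \<open>\<alpha>\<close>.  The possible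
  values of \<open>Y \<alpha>\<close> are the complements of the color classes, enlarged by the set tagged with this
  very node if there is one.  So a set whose tag leaves the branch \<open>Y\<close> at \<open>\<alpha>\<close> is almost contained
  in \<open>Y \<alpha>\<close> (\<open>departure_level\<close>).  A positive set is settled at a node if it meets none of the \<open>Y \<beta>\<close>
  in a positive set.

  Every subset of \<open>\<omega>\<close> is a union of color classes of some level, and a positive set is the union of two
  disjoint positive sets (\<open>pos_split\<close>); hence every settled positive set is split into two at some
  level (\<open>ex_splitting_level\<close>).  Positive sets have positive pseudo-intersections along decreasing
  sequences, so iterating the splitting along all binary sequences gives \<open>c\<close> pairwise incompatible
  nodes at which some positive subset of \<open>B\<close> is settled.  Fewer than \<open>c\<close> tags are in use, and so one
  of these nodes has no tag at or above it (\<open>ex_free_node\<close>).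

  Let the positive set \<open>e\<close> be settled at such a free node \<open>(\<xi>, Y)\<close>.  Then fewer than \<open>b\<close> of the
  chosen sets meet \<open>e\<close> in an infinite set (\<open>settled_meets_few\<close>), and by the definition of \<open>b\<close> some
  infinite subset of \<open>e\<close> is almost disjoint from all chosen sets (\<open>ex_orthogonal\<close>).  The reason is
  that every chosen set leaves the branch below \<open>\<xi>\<close>, only finitely many that meet \<open>e\<close> in an
  infinite set leave it at the same level, and so otherwise the set \<open>X\<close> of levels of departure has
  at least \<open>b\<close> elements.  The colors are designed to rule this out.  Level \<open>\<alpha>\<close> guesses a countable
  set \<open>v\<close> of lower levels and a function \<open>g\<close>; one of its colors is the set of points \<open>m\<close> that lie in
  some \<open>Y \<beta>\<close> with \<open>\<beta>\<close> in \<open>v\<close>, but only in such ones for which \<open>m\<close> is below the value of \<open>g\<close> at the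
  index of \<open>\<beta>\<close> in \<open>v\<close>.  If \<open>v\<close> meets \<open>X\<close> in an infinite set, infinitely many chosen sets leave the
  branch at a level in \<open>v\<close>, and each is almost disjoint from that color on \<open>Y \<beta>\<close>, where \<open>\<beta>\<close> is its
  level of departure; while if \<open>g\<close> is not eventually dominated by a suitable function, infinitely
  many others meet that color within \<open>e\<close> in an infinite set.  So \<open>e\<close> would be split at \<open>\<alpha>\<close>,
  although it is settled there.

  It remains to well-order the levels so that for every set \<open>X\<close> of at least \<open>b\<close> levels there is
  a single \<open>v\<close>, meeting \<open>X\<close> in an infinite set, which is guessed together with an unbounded family
  of functions at levels that are not above all of \<open>X\<close>.  Only here is \<open>c < \<aleph>\<^sub>\<omega>\<close> used: \<open>ex_guesses\<close>
  constructs such orders on sets of size \<open>\<aleph>\<^sub>n\<close> by induction on \<open>n\<close>, as lexicographic products.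
\<close>

section \<open>Index sets smaller than the bounding number\<close>

text \<open>
  This says that \<open>X\<close> has fewer than \<open>b\<close> elements, where \<open>b\<close> is the bounding number: \<open>b\<close> is the
  least size of a family of functions that is not eventually dominated by a single function.
\<close>

definition less_b :: "'a set \<Rightarrow> bool" where
  "less_b X \<longleftrightarrow> (\<forall>f :: 'a \<Rightarrow> nat \<Rightarrow> nat. \<exists>h. \<forall>x\<in>X. \<forall>\<^sub>F n in sequentially. f x n \<le> h n)"

lemma less_bD:
  assumes "less_b X"
  shows "\<exists>h. \<forall>x\<in>X. \<forall>\<^sub>F n in sequentially. f x n \<le> (h n :: nat)"
  using assms unfolding less_b_def by (rule spec)

lemma less_b_ordLeq:
  assumes "less_b X" "|Y| \<le>o |X|"
  shows "less_b Y"
  unfolding less_b_def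
proof
  fix f :: "'b \<Rightarrow> nat \<Rightarrow> nat"
  obtain i where i: "inj_on i Y" "i ` Y \<subseteq> X"
    using assms(2) unfolding card_of_ordLeq[symmetric] by blast
  obtain h where h: "\<And>x. x \<in> X \<Longrightarrow> \<forall>\<^sub>F n in sequentially. f (inv_into Y i x) n \<le> h n"
    using less_bD[OF assms(1), of "\<lambda>x. f (inv_into Y i x)"] by auto
  have "\<forall>\<^sub>F n in sequentially. f y n \<le> h n" if "y \<in> Y" for y
    using h[of "i y"] i that by (auto simp: inv_into_f_f)
  then show "\<exists>h. \<forall>y\<in>Y. \<forall>\<^sub>F n in sequentially. f y n \<le> h n" by blast
qed

lemma less_b_subset: "less_b X \<Longrightarrow> Y \<subseteq> X \<Longrightarrow> less_b Y"
  using less_b_ordLeq card_of_mono1 by blast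

lemma less_b_UN_countable:
  assumes I: "countable I" and X: "\<And>i. i \<in> I \<Longrightarrow> less_b (X i)"
  shows "less_b (\<Union>i\<in>I. X i)"
  unfolding less_b_def
proof
  fix f :: "'b \<Rightarrow> nat \<Rightarrow> nat"
  have "\<forall>i\<in>I. \<exists>h. \<forall>x\<in>X i. \<forall>\<^sub>F n in sequentially. f x n \<le> h n"
    using X unfolding less_b_def by blast
  then obtain h where h: "\<And>i x. i \<in> I \<Longrightarrow> x \<in> X i \<Longrightarrow> \<forall>\<^sub>F n in sequentially. f x n \<le> h i n"
    by metis
  define H where "H n = (\<Sum>k\<le>n. h (from_nat_into I k) n)" for n
  have "\<forall>\<^sub>F n in sequentially. f x n \<le> H n" if "i \<in> I" "x \<in> X i" for i x
  proof -
    have le: "h i n \<le> H n" if "to_nat_on I i \<le> n" for n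
    proof -
      have "h i n = h (from_nat_into I (to_nat_on I i)) n" using I \<open>i \<in> I\<close> by simp
      also have "\<dots> \<le> H n" unfolding H_def
        by (rule member_le_sum[of _ _ "\<lambda>k. h (from_nat_into I k) n"]) (use that in auto)
      finally show ?thesis .
    qed
    show ?thesis
      using h[OF that] eventually_ge_at_top[of "to_nat_on I i"]
      by eventually_elim (use le order_trans in blast)
  qed
  then show "\<exists>H. \<forall>x\<in>(\<Union>i\<in>I. X i). \<forall>\<^sub>F n in sequentially. f x n \<le> H n" by blast
qed

lemma less_b_finite_to_one:
  fixes p :: "'a \<Rightarrow> 'b"
  assumes X: "less_b (p ` X)" and fin: "\<And>y. finite {x \<in> X. p x = y}"
  shows "less_b X"
  unfolding less_b_def
proof
  fix f :: "'a \<Rightarrow> nat \<Rightarrow> nat"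
  obtain h where h: "\<And>y. y \<in> p ` X \<Longrightarrow>
      \<forall>\<^sub>F n in sequentially. (\<Sum>x\<in>{x \<in> X. p x = y}. f x n) \<le> h n"
    using less_bD[OF X, of "\<lambda>y n. \<Sum>x\<in>{x \<in> X. p x = y}. f x n"] by auto
  have "\<forall>\<^sub>F n in sequentially. f x n \<le> h n" if "x \<in> X" for x
  proof -
    have "f x n \<le> (\<Sum>z\<in>{z \<in> X. p z = p x}. f z n)" for n
      using that fin by (intro member_le_sum[of _ _ "\<lambda>z. f z n"]) auto
    with h[of "p x"] that show ?thesis
      by (auto elim!: eventually_mono intro: order_trans)
  qed
  then show "\<exists>h. \<forall>x\<in>X. \<forall>\<^sub>F n in sequentially. f x n \<le> h n" by blast
qed

lemma less_b_countable:
  fixes X :: "'a set"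
  assumes "countable X"
  shows "less_b X"
proof -
  note assms
  moreover have "less_b {x}" for x :: 'a
    unfolding less_b_def
  proof
    fix f :: "'a \<Rightarrow> nat \<Rightarrow> nat"
    show "\<exists>h. \<forall>y\<in>{x}. \<forall>\<^sub>F n in sequentially. f y n \<le> h n"
      by (rule exI[of _ "f x"]) simp
  qed
  ultimately have U: "less_b (\<Union>x\<in>X. {x})"
    using less_b_UN_countable[of X "\<lambda>x. {x}"] by blast
  show ?thesis by (rule less_b_subset[OF U]) blast
qed

text \<open>
  Replacing each function of an unbounded family by its partial sums makes it monotone without
  making it smaller.
\<close>

lemma not_less_b_mono:
  assumes "\<not> less_b X"
  shows "\<exists>f :: 'a \<Rightarrow> nat \<Rightarrow> nat. (\<forall>x. mono (f x)) \<and> (\<forall>h. \<exists>x\<in>X. \<exists>\<^sub>F n in sequentially. h n < f x n)"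
proof -
  obtain f :: "'a \<Rightarrow> nat \<Rightarrow> nat"
    where f: "\<And>h. \<exists>x\<in>X. \<not> (\<forall>\<^sub>F n in sequentially. f x n \<le> h n)"
    using assms unfolding less_b_def by blast
  define F where "F x n = (\<Sum>k\<le>n. f x k)" for x n
  have "f x n \<le> F x n" for x n
    unfolding F_def by (rule member_le_sum) auto
  note le = this
  have "\<exists>x\<in>X. \<exists>\<^sub>F n in sequentially. h n < F x n" for h
  proof -
    obtain x where x: "x \<in> X" "\<exists>\<^sub>F n in sequentially. h n < f x n"
      using f[of h] by (auto simp: not_eventually not_le)
    from x(2) have "\<exists>\<^sub>F n in sequentially. h n < F x n"
      by (rule frequently_elim1) (use le less_le_trans in blast)
    with x(1) show ?thesis by blast
  qed
  moreover have "mono (F x)" for x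
    unfolding F_def by (intro monoI sum_mono2) auto
  ultimately show ?thesis by (intro exI[of _ F] conjI allI)
qed

section \<open>Strict well-orders and covers by countable sets\<close>

text \<open>
  The field of \<open>R\<close> does not determine \<open>S\<close>: a well-order of a singleton has no strict pairs.
\<close>

definition strict_wo :: "'a set \<Rightarrow> 'a rel \<Rightarrow> bool" where
  "strict_wo S R \<longleftrightarrow> wf R \<and> trans R \<and> total_on S R \<and> R \<subseteq> S \<times> S"

lemma strict_wo_card_of:
  "strict_wo S ( |S| - Id)" "a \<in> S \<Longrightarrow> |{b. (b, a) \<in> |S| - Id}| <o |S|"
proof -
  have wo: "well_order_on S |S|" by (rule card_of_well_order_on)
  then have "trans ( |S| - Id)"
    unfolding well_order_on_def linear_order_on_def partial_order_on_def preorder_on_def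
    by (meson trans_diff_Id)
  moreover have "|S| - Id \<subseteq> S \<times> S"
    using wo well_order_on_Field[OF wo] by (auto simp: Field_def)
  ultimately show "strict_wo S ( |S| - Id)"
    using wo unfolding strict_wo_def well_order_on_def linear_order_on_def by simp
  assume "a \<in> S"
  then have "|underS |S| a| <o |S|"
    by (intro card_of_underS card_of_Card_order) (simp add: Field_card_of)
  moreover have "underS |S| a = {b. (b, a) \<in> |S| - Id}" unfolding underS_def by auto
  ultimately show "|{b. (b, a) \<in> |S| - Id}| <o |S|" by simp
qed

lemma strict_wo_irrefl: "strict_wo S R \<Longrightarrow> (a, a) \<notin> R"
  unfolding strict_wo_def by auto

lemma strict_wo_trans: "strict_wo S R \<Longrightarrow> (a, b) \<in> R \<Longrightarrow> (b, c) \<in> R \<Longrightarrow> (a, c) \<in> R"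
  unfolding strict_wo_def by (auto dest: transD)

lemma strict_wo_total: "strict_wo S R \<Longrightarrow> a \<in> S \<Longrightarrow> b \<in> S \<Longrightarrow> (a, b) \<in> R \<or> a = b \<or> (b, a) \<in> R"
  unfolding strict_wo_def total_on_def by blast

lemma strict_wo_min:
  assumes "strict_wo S R" "x \<in> Z"
  obtains z where "z \<in> Z" "\<And>y. (y, z) \<in> R \<Longrightarrow> y \<notin> Z"
  using assms wfE_min unfolding strict_wo_def by metis

lemma strict_wo_mem: "strict_wo S R \<Longrightarrow> (a, b) \<in> R \<Longrightarrow> a \<in> S \<and> b \<in> S"
  unfolding strict_wo_def by blast

text \<open>
  Counting the predecessors embeds \<open>Z\<close> into the natural numbers.
\<close>

lemma strict_wo_countable:
  assumes wo: "strict_wo S R" and Z: "Z \<subseteq> S" and fin: "\<And>z. z \<in> Z \<Longrightarrow> finite {y \<in> Z. (y, z) \<in> R}"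
  shows "countable Z"
proof -
  define c where "c z = card {y \<in> Z. (y, z) \<in> R}" for z
  have less: "c y < c z" if "y \<in> Z" "z \<in> Z" "(y, z) \<in> R" for y z
    unfolding c_def
  proof (rule psubset_card_mono)
    show "{x \<in> Z. (x, y) \<in> R} \<subset> {y \<in> Z. (y, z) \<in> R}"
      using that strict_wo_trans[OF wo] strict_wo_irrefl[OF wo] by blast
  qed (use fin that in auto)
  have "inj_on c Z"
  proof (rule inj_onI, rule ccontr)
    fix y z assume "y \<in> Z" "z \<in> Z" "c y = c z" "y \<noteq> z"
    then show False using less[of y z] less[of z y] strict_wo_total[OF wo, of y z] Z by auto
  qed
  then show ?thesis by (rule countableI)
qed

text \<open>
  The element \<open>j\<close> is the first one with infinitely many predecessors in \<open>Z\<close>, that is, the one at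
  position \<open>\<omega>\<close>; its predecessors form the countable set that later gets guessed, and \<open>z\<close> leaves
  room above \<open>j\<close> for the guess itself.
\<close>

lemma strict_wo_infinite_predecessors:
  assumes wo: "strict_wo S R" and Z: "Z \<subseteq> S" "uncountable Z"
  obtains j z where "j \<in> Z" "z \<in> Z" "(j, z) \<in> R" "infinite {y \<in> Z. (y, j) \<in> R}"
    "countable {y \<in> Z. (y, j) \<in> R}"
proof -
  define P where "P = {z \<in> Z. infinite {y \<in> Z. (y, z) \<in> R}}"
  have "P \<noteq> {}" using strict_wo_countable[OF wo Z(1)] Z(2) unfolding P_def by blast
  then obtain j where j: "j \<in> P" "\<And>y. (y, j) \<in> R \<Longrightarrow> y \<notin> P"
    using strict_wo_min[OF wo] by (metis ex_in_conv)
  define D where "D = {y \<in> Z. (y, j) \<in> R}"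
  have cD: "countable D"
  proof (rule strict_wo_countable[OF wo])
    show "D \<subseteq> S" using Z D_def by auto
    fix d assume "d \<in> D"
    then have "finite {y \<in> Z. (y, d) \<in> R}" using j(2) unfolding P_def D_def by auto
    then show "finite {y \<in> D. (y, d) \<in> R}" by (rule rev_finite_subset) (auto simp: D_def)
  qed
  have "\<not> Z \<subseteq> insert j D" using cD Z(2) countable_subset by (metis countable_insert)
  then obtain z where "z \<in> Z" "z \<noteq> j" "z \<notin> D" by blast
  moreover have "j \<in> Z" using j P_def by auto
  ultimately have "(j, z) \<in> R" using strict_wo_total[OF wo, of j z] Z unfolding D_def by auto
  then show thesis using that[OF \<open>j \<in> Z\<close> \<open>z \<in> Z\<close>] j(1) cD unfolding P_def D_def by auto
qed

lemma strict_wo_cardSuc: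
  assumes k: "Card_order k" and S: "|S| \<le>o cardSuc k" and a: "a \<in> S"
  shows "|{b. (b, a) \<in> |S| - Id}| \<le>o k"
proof -
  have "|{b. (b, a) \<in> |S| - Id}| <o cardSuc k"
    using strict_wo_card_of(2)[OF a] S by (rule ordLess_ordLeq_trans)
  then show ?thesis
    using cardSuc_ordLeq_ordLess[OF k card_of_Card_order] by blast
qed

lemma countable_iff_natLeq: "countable D \<longleftrightarrow> |D| \<le>o natLeq"
proof -
  have "countable D \<longleftrightarrow> |D| \<le>o |UNIV :: nat set|"
    unfolding countable_def card_of_ordLeq[symmetric] by simp
  also have "\<dots> \<longleftrightarrow> |D| \<le>o natLeq"
    using ordLeq_ordIso_trans[OF _ card_of_nat] ordLeq_ordIso_trans[OF _ ordIso_symmetric[OF card_of_nat]]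
    by blast
  finally show ?thesis .
qed

lemma is_aleph_natLeq: "is_aleph n (k :: 'a rel) \<Longrightarrow> natLeq \<le>o k"
proof (induction n arbitrary: k)
  case 0
  then show ?case by (simp add: ordIso_iff_ordLeq)
next
  case (Suc n)
  then obtain l :: "'a rel" where l: "is_aleph n l" "k =o cardSuc l" by auto
  have "natLeq \<le>o l" by (rule Suc.IH[OF l(1)])
  also have "l \<le>o cardSuc l" by (rule cardSuc_ordLeq[OF is_aleph_Card_order[OF l(1)]])
  also have "cardSuc l =o k" by (rule ordIso_symmetric[OF l(2)])
  finally show ?case .
qed

lemma is_aleph_infinite:
  assumes "is_aleph n (k :: 'a rel)"
  shows "infinite (Field k)"
proof -
  have "natLeq \<le>o |Field k|"
    using is_aleph_natLeq[OF assms]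
      ordIso_symmetric[OF card_of_Field_ordIso[OF is_aleph_Card_order[OF assms]]]
    by (rule ordLeq_ordIso_trans)
  then show ?thesis using infinite_iff_natLeq_ordLeq by blast
qed

lemma countable_ordLeq_infinite:
  assumes "countable D" "Card_order k" "infinite (Field k)"
  shows "|D| \<le>o k"
proof -
  have "|D| \<le>o natLeq"
    using assms(1) by (simp add: countable_iff_natLeq)
  also have "natLeq \<le>o |Field k|" using assms(3) infinite_iff_natLeq_ordLeq by blast
  also have "|Field k| =o k" by (rule card_of_Field_ordIso[OF assms(2)])
  finally show ?thesis .
qed

text \<open>
  If \<open>D\<close> were cofinal, \<open>S\<close> would be a countable union of initial segments, each of size at
  most \<open>k\<close>.
\<close>

lemma countable_bounded:
  assumes wo: "strict_wo S s" and k: "Card_order k" "infinite (Field k)"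
    and seg: "\<And>j. j \<in> S \<Longrightarrow> |{i. (i, j) \<in> s}| \<le>o k"
    and big: "\<not> |S| \<le>o k" and D: "countable D" "D \<subseteq> S"
  shows "\<exists>j\<in>S. \<forall>d\<in>D. (d, j) \<in> s"
proof (rule ccontr)
  assume unb: "\<not> (\<exists>j\<in>S. \<forall>d\<in>D. (d, j) \<in> s)"
  have "S \<subseteq> (\<Union>d\<in>D. insert d {i. (i, d) \<in> s})"
  proof
    fix j assume j: "j \<in> S"
    then obtain d where d: "d \<in> D" "(d, j) \<notin> s" using unb by blast
    then have "d = j \<or> (j, d) \<in> s" using strict_wo_total[OF wo j, of d] D(2) by auto
    with d(1) show "j \<in> (\<Union>d\<in>D. insert d {i. (i, d) \<in> s})" by blast
  qed
  then have "|S| \<le>o |\<Union>d\<in>D. insert d {i. (i, d) \<in> s}|" by (rule card_of_mono1)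
  also have "|\<Union>d\<in>D. insert d {i. (i, d) \<in> s}| \<le>o k"
  proof (rule card_of_UNION_ordLeq_infinite_Field[OF k(2,1)])
    show "|D| \<le>o k" using countable_ordLeq_infinite D(1) k by blast
    have "|{d} \<union> {i. (i, d) \<in> s}| \<le>o k" if "d \<in> D" for d
      using seg[of d] that D(2) countable_ordLeq_infinite[of "{d}", OF _ k] k
      by (intro card_of_Un_ordLeq_infinite_Field) auto
    then show "\<forall>d\<in>D. |insert d {i. (i, d) \<in> s}| \<le>o k" by simp
  qed
  finally show False using big by simp
qed

definition covers :: "'a set set \<Rightarrow> 'a set \<Rightarrow> bool" where
  "covers \<C> S \<longleftrightarrow> (\<forall>C\<in>\<C>. countable C \<and> C \<subseteq> S) \<and> (\<forall>D\<subseteq>S. countable D \<longrightarrow> (\<exists>C\<in>\<C>. D \<subseteq> C))"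

text \<open>
  The cofinality of the countable subsets of \<open>\<aleph>\<^sub>n\<close> is at most \<open>\<aleph>\<^sub>n\<close>.  In the step,
  every countable subset of \<open>S\<close> lies in a proper initial segment, so that the covers of the
  initial segments, provided by the induction hypothesis, can be collected.
\<close>

lemma ex_small_cover:
  fixes k :: "'k rel" and S :: "'a set"
  assumes "is_aleph n k" "|S| \<le>o k"
  shows "\<exists>\<C>. |\<C>| \<le>o k \<and> covers \<C> S"
  using assms
proof (induction n arbitrary: k S)
  case 0
  then have "k =o natLeq" by simp
  with 0(2) have "|S| \<le>o natLeq" by (rule ordLeq_ordIso_trans)
  then have "countable S" by (simp add: countable_iff_natLeq)
  then have "covers {S} S" unfolding covers_def by blast
  moreover have "|{S}| \<le>o k"
    using countable_ordLeq_infinite[of "{S}" k] is_aleph_infinite[OF 0(1)] is_aleph_Card_order[OF 0(1)]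
    by simp
  ultimately show ?case by blast
next
  case (Suc n)
  then obtain l :: "'k rel" where l: "is_aleph n l" "k =o cardSuc l" by auto
  note l' = is_aleph_Card_order[OF l(1)] is_aleph_infinite[OF l(1)]
  note k' = is_aleph_Card_order[OF Suc.prems(1)] is_aleph_infinite[OF Suc.prems(1)]
  have Ssuc: "|S| \<le>o cardSuc l" using Suc.prems(2) l(2) by (rule ordLeq_ordIso_trans)
  have lk: "l \<le>o k"
    using cardSuc_ordLeq[OF l'(1)] ordIso_symmetric[OF l(2)] by (rule ordLeq_ordIso_trans)
  show ?case
  proof (cases "|S| \<le>o l")
    case True
    then obtain \<C> where "|\<C>| \<le>o l" "covers \<C> S" using Suc.IH[OF l(1)] by blast
    then show ?thesis using ordLeq_transitive[OF _ lk] by blast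
  next
    case False
    define s where "s = |S| - Id"
    have wo: "strict_wo S s" unfolding s_def by (rule strict_wo_card_of)
    have seg: "|{i. (i, j) \<in> s}| \<le>o l" if "j \<in> S" for j
      unfolding s_def using strict_wo_cardSuc[OF l'(1) Ssuc that] .
    have "\<forall>j\<in>S. \<exists>\<C>. |\<C>| \<le>o l \<and> covers \<C> {i. (i, j) \<in> s}"
      using Suc.IH[OF l(1) seg] by (rule ballI)
    then obtain \<C> where "\<forall>j\<in>S. |\<C> j| \<le>o l \<and> covers (\<C> j) {i. (i, j) \<in> s}"
      by (rule bchoice[THEN exE])
    then have \<C>: "\<And>j. j \<in> S \<Longrightarrow> |\<C> j| \<le>o l" "\<And>j. j \<in> S \<Longrightarrow> covers (\<C> j) {i. (i, j) \<in> s}"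
      by simp_all
    have "|\<Union>j\<in>S. \<C> j| \<le>o k"
      using \<C>(1) ordLeq_transitive[OF _ lk]
      by (intro card_of_UNION_ordLeq_infinite_Field[OF k'(2,1) Suc.prems(2)]) blast
    moreover have "covers (\<Union>j\<in>S. \<C> j) S"
      unfolding covers_def
    proof (intro conjI ballI allI impI)
      fix C assume "C \<in> (\<Union>j\<in>S. \<C> j)"
      then obtain j where j: "j \<in> S" "C \<in> \<C> j" by blast
      then have C: "countable C" "C \<subseteq> {i. (i, j) \<in> s}"
        using \<C>(2)[OF j(1)] unfolding covers_def by simp_all
      show "countable C" by (rule C(1))
      show "C \<subseteq> S" using C(2) strict_wo_mem[OF wo] by blast
    next
      fix D assume D: "D \<subseteq> S" "countable D"
      then obtain j where j: "j \<in> S" "\<forall>d\<in>D. (d, j) \<in> s"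
        using countable_bounded[OF wo l' seg False] by blast
      from j(2) have "D \<subseteq> {i. (i, j) \<in> s}" by blast
      with \<C>(2)[OF j(1)] D(2) have "\<exists>C\<in>\<C> j. D \<subseteq> C"
        unfolding covers_def by meson
      with j(1) show "\<exists>C\<in>(\<Union>j\<in>S. \<C> j). D \<subseteq> C" by blast
    qed
    ultimately show ?thesis by blast
  qed
qed

section \<open>Well-orders that guess infinite countable sets\<close>

text \<open>
  The levels \<open>\<alpha>\<close> that guess the same \<open>v\<close> carry functions that no single \<open>h\<close> eventually dominates,
  even if only levels bounded by some element of \<open>X\<close> are considered.
\<close>

definition guesses :: "'a set \<Rightarrow> 'a rel \<Rightarrow> ('a \<Rightarrow> 'a set) \<Rightarrow> ('a \<Rightarrow> nat \<Rightarrow> nat) \<Rightarrow> bool" where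
  "guesses S R u g \<longleftrightarrow>
    (\<forall>\<alpha>\<in>S. countable (u \<alpha>) \<and> u \<alpha> \<subseteq> {\<beta>. (\<beta>, \<alpha>) \<in> R} \<and> mono (g \<alpha>)) \<and>
    (\<forall>X\<subseteq>S. \<not> less_b X \<longrightarrow>
      (\<exists>v. infinite (v \<inter> X) \<and>
        (\<forall>h. \<exists>\<alpha>\<in>S. u \<alpha> = v \<and> (\<exists>\<beta>\<in>X. \<alpha> = \<beta> \<or> (\<alpha>, \<beta>) \<in> R) \<and>
          (\<exists>\<^sub>F n in sequentially. h n < g \<alpha> n))))"

text \<open>
  The unbounded family of functions has to be spread over the first coordinates \<open>j\<close> of the
  lexicographic product in portions of size at most \<open>k\<close>.  If \<open>T\<close> already has at least \<open>b\<close>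
  elements, a whole unbounded family fits everywhere.  If only \<open>S\<close> does, portion \<open>j\<close> consists of
  the functions with index at most \<open>j\<close>; the portions are then jointly unbounded along every
  cofinal \<open>Z\<close>, and no other \<open>Z\<close> will matter.
\<close>

lemma ex_local_unbounded:
  assumes wo: "strict_wo S s" and k: "Card_order k" "infinite (Field k)"
    and seg: "\<And>j. j \<in> S \<Longrightarrow> |{i. (i, j) \<in> s}| \<le>o k" and T: "|T| \<le>o k"
  shows "\<exists>\<Gamma> :: 'a \<Rightarrow> (nat \<Rightarrow> nat) set.
    (\<forall>j\<in>S. \<Gamma> j \<noteq> {} \<and> |\<Gamma> j| \<le>o k \<and> (\<forall>f\<in>\<Gamma> j. mono f)) \<and>
    (\<forall>j\<^sub>0\<in>S. \<forall>Z\<subseteq>S. \<forall>h. (\<exists>z\<in>Z. (j\<^sub>0, z) \<in> s) \<longrightarrow>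
      \<not> less_b T \<or> \<not> less_b S \<and> (\<forall>j\<in>S. \<exists>z\<in>Z. (j, z) \<in> s) \<longrightarrow>
      (\<exists>j\<in>S. (j = j\<^sub>0 \<or> (j\<^sub>0, j) \<in> s) \<and> (\<exists>z\<in>Z. (j, z) \<in> s) \<and>
        (\<exists>f\<in>\<Gamma> j. \<exists>\<^sub>F n in sequentially. h n < f n)))"
proof -
  consider "\<not> less_b T" | "less_b T" "\<not> less_b S" | "less_b T" "less_b S" by blast
  then show ?thesis
  proof cases
    case 1
    obtain f :: "_ \<Rightarrow> nat \<Rightarrow> nat" where "(\<forall>t. mono (f t)) \<and> (\<forall>h. \<exists>t\<in>T. \<exists>\<^sub>F n in sequentially. h n < f t n)"
      using not_less_b_mono[OF 1] by (rule exE)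
    then have f: "\<And>t. mono (f t)" "\<And>h. \<exists>t\<in>T. \<exists>\<^sub>F n in sequentially. h n < f t n"
      by blast+
    show ?thesis
    proof (rule exI[of _ "\<lambda>_. f ` T"], rule conjI; intro ballI allI impI)
      fix j
      show "f ` T \<noteq> {} \<and> |f ` T| \<le>o k \<and> (\<forall>f\<in>f ` T. mono f)"
        using f ordLeq_transitive[OF card_of_image T] by blast
    next
      fix j\<^sub>0 Z h assume "j\<^sub>0 \<in> S" "\<exists>z\<in>Z. (j\<^sub>0, z) \<in> s"
      moreover have "\<exists>f\<in>f ` T. \<exists>\<^sub>F n in sequentially. h n < f n" using f(2)[of h] by blast
      ultimately show "\<exists>j\<in>S. (j = j\<^sub>0 \<or> (j\<^sub>0, j) \<in> s) \<and> (\<exists>z\<in>Z. (j, z) \<in> s) \<and>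
        (\<exists>f\<in>f ` T. \<exists>\<^sub>F n in sequentially. h n < f n)" by blast
    qed
  next
    case 2
    obtain f :: "_ \<Rightarrow> nat \<Rightarrow> nat" where "(\<forall>t. mono (f t)) \<and> (\<forall>h. \<exists>t\<in>S. \<exists>\<^sub>F n in sequentially. h n < f t n)"
      using not_less_b_mono[OF 2(2)] by (rule exE)
    then have f: "\<And>t. mono (f t)" "\<And>h. \<exists>t\<in>S. \<exists>\<^sub>F n in sequentially. h n < f t n"
      by blast+
    define \<Gamma> where "\<Gamma> j = f ` ({j} \<union> {i. (i, j) \<in> s})" for j
    show ?thesis
    proof (rule exI[of _ \<Gamma>], rule conjI; intro ballI allI impI)
      fix j assume j: "j \<in> S"
      have "|{j} \<union> {i. (i, j) \<in> s}| \<le>o k"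
        using seg[OF j] countable_ordLeq_infinite[of "{j}", OF _ k] k
        by (intro card_of_Un_ordLeq_infinite_Field) auto
      then have "|\<Gamma> j| \<le>o k" unfolding \<Gamma>_def by (rule ordLeq_transitive[OF card_of_image])
      then show "\<Gamma> j \<noteq> {} \<and> |\<Gamma> j| \<le>o k \<and> (\<forall>f\<in>\<Gamma> j. mono f)"
        using f(1) unfolding \<Gamma>_def by auto
    next
      fix j\<^sub>0 Z h assume j0: "j\<^sub>0 \<in> S" and Z: "Z \<subseteq> S"
        and "\<not> less_b T \<or> \<not> less_b S \<and> (\<forall>j\<in>S. \<exists>z\<in>Z. (j, z) \<in> s)"
      with 2 have cof: "\<forall>j\<in>S. \<exists>z\<in>Z. (j, z) \<in> s" by blast
      obtain i where i: "i \<in> S" "\<exists>\<^sub>F n in sequentially. h n < f i n" using f(2)[of h] by blast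
      define j where "j = (if (j\<^sub>0, i) \<in> s then i else j\<^sub>0)"
      have "j \<in> S" "j = j\<^sub>0 \<or> (j\<^sub>0, j) \<in> s" using i j0 unfolding j_def by auto
      moreover have "f i \<in> \<Gamma> j"
        using strict_wo_total[OF wo i(1) j0] unfolding j_def \<Gamma>_def by auto
      ultimately show "\<exists>j\<in>S. (j = j\<^sub>0 \<or> (j\<^sub>0, j) \<in> s) \<and> (\<exists>z\<in>Z. (j, z) \<in> s) \<and>
        (\<exists>f\<in>\<Gamma> j. \<exists>\<^sub>F n in sequentially. h n < f n)" using i(2) cof by blast
    qed
  next
    case 3
    show ?thesis
    proof (rule exI[of _ "\<lambda>_. {\<lambda>_. 0}"], rule conjI; intro ballI allI impI)
      fix j
      show "{\<lambda>_. 0} \<noteq> {} \<and> |{\<lambda>_. 0 :: nat}| \<le>o k \<and> (\<forall>f\<in>{\<lambda>_ :: nat. 0 :: nat}. mono f)"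
        using countable_ordLeq_infinite[of "{\<lambda>_. 0 :: nat}", OF _ k] by (simp add: mono_def)
    qed (use 3 in blast)
  qed
qed

text \<open>
  The new order on \<open>S\<close> is the lexicographic product of \<open>S\<close>, \<open>T\<close> and a two-element order.  Inside
  the block with first coordinate \<open>j\<close>, the points \<open>(j, t, False)\<close> repeat the guesses made by \<open>T\<close>,
  and the points \<open>(j, t, True)\<close> run through all pairs of a member of a cover of the earlier blocks
  and a function of the \<open>j\<close>-th portion.
  
  Let \<open>X\<close> have at least \<open>b\<close> elements.  If this is so already for its part in one block, the
  guesses of \<open>T\<close> work.  Otherwise \<open>X\<close> meets uncountably many blocks, since countable unions of
  sets of size less than \<open>b\<close> have size less than \<open>b\<close>.  Let \<open>j\<^sub>0\<close> be the block at position \<open>\<omega>\<close>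
  among these.  Choosing one point of \<open>X\<close> in each of the preceding ones yields a countable set that
  is covered by some \<open>v\<close>, and \<open>v\<close> is guessed in every block from \<open>j\<^sub>0\<close> on, before \<open>X\<close> ends.
\<close>

lemma guesses_step:
  fixes S T :: "'a set"
  assumes wo: "strict_wo S s" and seg: "\<And>j. j \<in> S \<Longrightarrow> |{i. (i, j) \<in> s}| \<le>o |T|"
    and T: "T \<subseteq> S" "infinite T" and big: "\<not> |S| \<le>o |T|"
    and woT: "strict_wo T r" and gT: "guesses T r p q"
    and cov: "\<And>N :: 'a set. |N| \<le>o |T| \<Longrightarrow> \<exists>\<C>. |\<C>| \<le>o |T| \<and> covers \<C> N"
  shows "\<exists>R u g. strict_wo S R \<and> guesses S R u g \<and>
    (\<forall>D\<subseteq>S. countable D \<longrightarrow> (\<exists>\<beta>\<in>S. \<forall>d\<in>D. (d, \<beta>) \<in> R))"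
proof -
  let ?k = "|T|"
  have k: "Card_order ?k" "infinite (Field ?k)"
    using T(2) card_of_Card_order[of T] by (simp_all add: Field_card_of)
  have TxB: "|T \<times> (UNIV :: bool set)| \<le>o ?k"
    by (rule card_of_Times_ordLeq_infinite_Field[OF k(2) ordLeq_refl[OF k(1)]
          countable_ordLeq_infinite[OF _ k] k(1)]) (simp add: countable_finite)
  have "|S \<times> (T \<times> (UNIV :: bool set))| =o |S|"
  proof (rule card_of_Times_infinite_simps(1))
    show "infinite S" using T finite_subset by blast
    show "T \<times> (UNIV :: bool set) \<noteq> {}" using T(2) by auto
    show "|T \<times> (UNIV :: bool set)| \<le>o |S|"
      by (rule ordLeq_transitive[OF TxB card_of_mono1[OF T(1)]])
  qed
  then obtain \<psi> where \<psi>: "bij_betw \<psi> (S \<times> (T \<times> (UNIV :: bool set))) S"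
    unfolding card_of_ordIso[symmetric] by blast
  define \<phi> where "\<phi> = inv_into (S \<times> (T \<times> (UNIV :: bool set))) \<psi>"
  have \<phi>\<psi>: "\<phi> (\<psi> (j, t, b)) = (j, t, b)" "\<psi> (j, t, b) \<in> S" if "j \<in> S" "t \<in> T" for j t b
    using \<psi> that unfolding \<phi>_def bij_betw_def by (auto simp: inv_into_f_f)
  have bij: "bij_betw \<phi> S (S \<times> (T \<times> (UNIV :: bool set)))"
    unfolding \<phi>_def by (rule bij_betw_inv_into[OF \<psi>])
  then have inj: "inj_on \<phi> S" and im: "\<phi> ` S = S \<times> (T \<times> UNIV)" unfolding bij_betw_def by auto
  define c1 where "c1 x = fst (\<phi> x)" for x
  define c2 where "c2 x = fst (snd (\<phi> x))" for x
  define c3 where "c3 x = snd (snd (\<phi> x))" for x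
  have \<phi>: "\<phi> x = (c1 x, c2 x, c3 x)" for x unfolding c1_def c2_def c3_def by simp
  have c12: "c1 x \<in> S" "c2 x \<in> T" if "x \<in> S" for x
    using im that \<phi>[of x] by (metis image_eqI mem_Sigma_iff)+
  define L where "L = s <*lex*> (r <*lex*> {(False, True)})"
  define R where "R = {(x, y). x \<in> S \<and> y \<in> S \<and> (\<phi> x, \<phi> y) \<in> L}"
  have R_iff: "(x, y) \<in> R \<longleftrightarrow> x \<in> S \<and> y \<in> S \<and> ((c1 x, c1 y) \<in> s \<or> c1 x = c1 y \<and>
      ((c2 x, c2 y) \<in> r \<or> c2 x = c2 y \<and> \<not> c3 x \<and> c3 y))" for x y
    unfolding R_def L_def \<phi> by auto
  have "wf {(False, True)}" by (simp add: wf_insert)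
  then have wfL: "wf L" using wo woT unfolding L_def strict_wo_def by (intro wf_lex_prod) auto
  have "R \<subseteq> inv_image L \<phi>" unfolding R_def by auto
  then have wfR: "wf R" using wfL by (meson wf_inv_image wf_subset)
  have transR: "trans R"
  proof (rule transI)
    fix x y z assume "(x, y) \<in> R" "(y, z) \<in> R"
    then show "(x, z) \<in> R"
      unfolding R_iff using strict_wo_trans[OF wo] strict_wo_trans[OF woT] by metis
  qed
  have totR: "total_on S R"
    unfolding total_on_def
  proof (intro ballI impI)
    fix x y assume xy: "x \<in> S" "y \<in> S" "x \<noteq> y"
    then have "\<phi> x \<noteq> \<phi> y" using inj by (auto dest: inj_onD)
    then show "(x, y) \<in> R \<or> (y, x) \<in> R"
      using strict_wo_total[OF wo c12(1)[OF xy(1)] c12(1)[OF xy(2)]]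
        strict_wo_total[OF woT c12(2)[OF xy(1)] c12(2)[OF xy(2)]] xy
      unfolding R_iff \<phi> by auto
  qed
  have woR: "strict_wo S R"
    unfolding strict_wo_def using wfR transR totR by (auto simp: R_def)
  have bd: "\<forall>D\<subseteq>S. countable D \<longrightarrow> (\<exists>\<beta>\<in>S. \<forall>d\<in>D. (d, \<beta>) \<in> R)"
  proof (intro allI impI)
    fix D assume D: "D \<subseteq> S" "countable D"
    have "countable (c1 ` D)" "c1 ` D \<subseteq> S" using D c12 by auto
    then obtain j where j: "j \<in> S" "\<forall>i\<in>c1 ` D. (i, j) \<in> s"
      using countable_bounded[OF wo k seg big] by blast
    obtain t where t: "t \<in> T" using T(2) by (metis finite.emptyI ex_in_conv)
    have "(d, \<psi> (j, t, True)) \<in> R" if "d \<in> D" for d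
    proof -
      have "c1 (\<psi> (j, t, True)) = j" using \<phi>\<psi>(1)[OF j(1) t] unfolding c1_def by simp
      then show ?thesis using that j D(1) \<phi>\<psi>(2)[OF j(1) t] unfolding R_iff by auto
    qed
    then show "\<exists>\<beta>\<in>S. \<forall>d\<in>D. (d, \<beta>) \<in> R" using \<phi>\<psi>(2)[OF j(1) t] by blast
  qed
  define N where "N j = {x \<in> S. (c1 x, j) \<in> s}" for j
  have small: "|{x \<in> S. c1 x \<in> I}| \<le>o ?k" if "|I| \<le>o ?k" for I
  proof -
    have "\<phi> ` {x \<in> S. c1 x \<in> I} \<subseteq> I \<times> (T \<times> UNIV)" using c12 \<phi> by auto
    moreover have "inj_on \<phi> {x \<in> S. c1 x \<in> I}" using inj by (rule inj_on_subset) auto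
    ultimately have "|{x \<in> S. c1 x \<in> I}| \<le>o |I \<times> (T \<times> (UNIV :: bool set))|"
      by (intro card_of_ordLeqI) (auto dest: inj_onD)
    also have "|I \<times> (T \<times> (UNIV :: bool set))| \<le>o ?k"
      by (rule card_of_Times_ordLeq_infinite_Field[OF k(2) that TxB k(1)])
    finally show ?thesis .
  qed
  have Nk: "|N j| \<le>o ?k" if "j \<in> S" for j
    using small[OF seg[OF that]] unfolding N_def by simp
  have "\<forall>j\<in>S. \<exists>\<C>. |\<C>| \<le>o |T| \<and> covers \<C> (N j)" using cov Nk by blast
  then obtain \<C> where "\<forall>j\<in>S. |\<C> j| \<le>o ?k \<and> covers (\<C> j) (N j)" by (rule bchoice[THEN exE])
  then have \<C>: "\<And>j. j \<in> S \<Longrightarrow> |\<C> j| \<le>o ?k" "\<And>j. j \<in> S \<Longrightarrow> covers (\<C> j) (N j)" by simp_all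
  \<comment> \<open>Taking unions makes the covers increase with \<open>j\<close>, so that a \<open>v\<close> once available stays so.\<close>
  define \<D> where "\<D> j = (\<Union>i\<in>{j} \<union> {i. (i, j) \<in> s}. \<C> i)" for j
  have \<D>k: "|\<D> j| \<le>o ?k" if j: "j \<in> S" for j
    unfolding \<D>_def
  proof (rule card_of_UNION_ordLeq_infinite_Field[OF k(2,1)])
    show "|{j} \<union> {i. (i, j) \<in> s}| \<le>o ?k"
      using seg[OF j] countable_ordLeq_infinite[of "{j}", OF _ k] k
      by (intro card_of_Un_ordLeq_infinite_Field) auto
    show "\<forall>i\<in>{j} \<union> {i. (i, j) \<in> s}. |\<C> i| \<le>o ?k"
      using \<C>(1) j strict_wo_mem[OF wo] by blast
  qed
  have \<D>C: "countable C" "C \<subseteq> N j" if C: "C \<in> \<D> j" "j \<in> S" for C j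
  proof -
    obtain i where i: "i = j \<or> (i, j) \<in> s" "C \<in> \<C> i"
      using C(1) unfolding \<D>_def by auto
    have iS: "i \<in> S" using i(1) C(2) strict_wo_mem[OF wo] by auto
    have "countable C" "C \<subseteq> N i" using \<C>(2)[OF iS] i(2) unfolding covers_def by simp_all
    moreover have "N i \<subseteq> N j" using i(1) strict_wo_trans[OF wo] unfolding N_def by auto
    ultimately show "countable C" "C \<subseteq> N j" by auto
  qed
  have \<D>0: "\<D> j \<noteq> {}" if "j \<in> S" for j
    using \<C>(2)[OF that] unfolding covers_def \<D>_def by blast
  obtain \<Gamma> :: "'a \<Rightarrow> (nat \<Rightarrow> nat) set" where "(\<forall>j\<in>S. \<Gamma> j \<noteq> {} \<and> |\<Gamma> j| \<le>o ?k \<and> (\<forall>f\<in>\<Gamma> j. mono f)) \<and>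
    (\<forall>j\<^sub>0\<in>S. \<forall>Z\<subseteq>S. \<forall>h. (\<exists>z\<in>Z. (j\<^sub>0, z) \<in> s) \<longrightarrow>
      \<not> less_b T \<or> \<not> less_b S \<and> (\<forall>j\<in>S. \<exists>z\<in>Z. (j, z) \<in> s) \<longrightarrow>
      (\<exists>j\<in>S. (j = j\<^sub>0 \<or> (j\<^sub>0, j) \<in> s) \<and> (\<exists>z\<in>Z. (j, z) \<in> s) \<and>
        (\<exists>f\<in>\<Gamma> j. \<exists>\<^sub>F n in sequentially. h n < f n)))"
    using ex_local_unbounded[OF wo k seg ordLeq_refl[OF k(1)]] by (rule exE)
  note \<Gamma> = this[THEN conjunct1, rule_format] this[THEN conjunct2, rule_format]
  have "\<forall>j\<in>S. \<exists>e. e ` T = \<D> j \<times> \<Gamma> j"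
  proof
    fix j assume j: "j \<in> S"
    have "|\<D> j \<times> \<Gamma> j| \<le>o |T|"
      using \<D>k[OF j] \<Gamma>(1)[OF j] by (intro card_of_Times_ordLeq_infinite_Field[OF k(2) _ _ k(1)]) auto
    moreover have "\<D> j \<times> \<Gamma> j \<noteq> {}" using \<D>0[OF j] \<Gamma>(1)[OF j] by auto
    ultimately show "\<exists>e. e ` T = \<D> j \<times> \<Gamma> j" by (simp add: card_of_ordLeq2)
  qed
  then obtain e where e: "\<forall>j\<in>S. e j ` T = \<D> j \<times> \<Gamma> j" by (rule bchoice[THEN exE])
  define u where "u x = (if c3 x then fst (e (c1 x) (c2 x)) else {y \<in> S. c1 y = c1 x \<and> c2 y \<in> p (c2 x)})" for x
  define g where "g x = (if c3 x then snd (e (c1 x) (c2 x)) else q (c2 x))" for x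
  have ug: "countable (u x) \<and> u x \<subseteq> {y. (y, x) \<in> R} \<and> mono (g x)" if x: "x \<in> S" for x
  proof (cases "c3 x")
    case True
    have "e (c1 x) (c2 x) \<in> e (c1 x) ` T" using c12[OF x] by blast
    then have "(u x, g x) \<in> \<D> (c1 x) \<times> \<Gamma> (c1 x)"
      using True e[rule_format, OF c12(1)[OF x]] unfolding u_def g_def by simp
    then have "countable (u x)" "u x \<subseteq> N (c1 x)" "mono (g x)"
      using \<D>C \<Gamma>(1) c12[OF x] by auto
    then show ?thesis using x unfolding N_def R_iff by auto
  next
    case False
    have pq: "countable (p (c2 x))" "p (c2 x) \<subseteq> {\<beta>. (\<beta>, c2 x) \<in> r}" "mono (q (c2 x))"
      using gT c12(2)[OF x] unfolding guesses_def by auto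
    have "\<phi> ` u x \<subseteq> {c1 x} \<times> (p (c2 x) \<times> UNIV)" using False \<phi> unfolding u_def by auto
    then have "countable (\<phi> ` u x)" by (rule countable_subset) (use pq(1) in auto)
    moreover have "inj_on \<phi> (u x)" using inj by (rule inj_on_subset) (use False in \<open>auto simp: u_def\<close>)
    ultimately have "countable (u x)" by (rule countable_image_inj_on)
    moreover have "u x \<subseteq> {y. (y, x) \<in> R}" using False pq(2) x unfolding u_def R_iff by auto
    ultimately show ?thesis using pq(3) False unfolding g_def by simp
  qed
  have main: "\<exists>v. infinite (v \<inter> X) \<and>
        (\<forall>h. \<exists>\<alpha>\<in>S. u \<alpha> = v \<and> (\<exists>\<beta>\<in>X. \<alpha> = \<beta> \<or> (\<alpha>, \<beta>) \<in> R) \<and>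
          (\<exists>\<^sub>F n in sequentially. h n < g \<alpha> n))" if X: "X \<subseteq> S" "\<not> less_b X" for X
  proof (cases "\<exists>j\<in>S. \<not> less_b {x \<in> X. c1 x = j}")
    case True
    then obtain j where j: "j \<in> S" "\<not> less_b {x \<in> X. c1 x = j}" by blast
    define Y where "Y = c2 ` {x \<in> X. c1 x = j}"
    have "\<not> less_b Y"
    proof
      assume "less_b Y"
      then have "less_b {x \<in> X. c1 x = j}"
        unfolding Y_def
      proof (rule less_b_finite_to_one)
        fix t
        have "\<phi> ` {x \<in> {x \<in> X. c1 x = j}. c2 x = t} \<subseteq> {j} \<times> ({t} \<times> UNIV)" using \<phi> by auto
        then have "finite (\<phi> ` {x \<in> {x \<in> X. c1 x = j}. c2 x = t})" by (rule finite_subset) simp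
        moreover have "inj_on \<phi> {x \<in> {x \<in> X. c1 x = j}. c2 x = t}"
          using inj by (rule inj_on_subset) (use X in auto)
        ultimately show "finite {x \<in> {x \<in> X. c1 x = j}. c2 x = t}" by (rule finite_imageD)
      qed
      then show False using j(2) by simp
    qed
    moreover have "Y \<subseteq> T" using X c12 unfolding Y_def by auto
    ultimately obtain v where v: "infinite (v \<inter> Y)"
      "\<And>h. \<exists>\<alpha>\<in>T. p \<alpha> = v \<and> (\<exists>\<beta>\<in>Y. \<alpha> = \<beta> \<or> (\<alpha>, \<beta>) \<in> r) \<and> (\<exists>\<^sub>F n in sequentially. h n < q \<alpha> n)"
      using gT unfolding guesses_def by meson
    define w where "w = {y \<in> S. c1 y = j \<and> c2 y \<in> v}"
    have "v \<inter> Y \<subseteq> c2 ` (w \<inter> X)" using X unfolding w_def Y_def by auto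
    then have "infinite (w \<inter> X)" using v(1) by (meson finite_imageI finite_subset)
    moreover have "\<exists>\<alpha>\<in>S. u \<alpha> = w \<and> (\<exists>\<beta>\<in>X. \<alpha> = \<beta> \<or> (\<alpha>, \<beta>) \<in> R) \<and>
          (\<exists>\<^sub>F n in sequentially. h n < g \<alpha> n)" for h
    proof -
      obtain t y where t: "t \<in> T" "p t = v" "y \<in> Y" "t = y \<or> (t, y) \<in> r"
        "\<exists>\<^sub>F n in sequentially. h n < q t n" using v(2)[of h] by blast
      obtain x where x: "x \<in> X" "c1 x = j" "c2 x = y" using t(3) unfolding Y_def by auto
      define \<alpha> where "\<alpha> = \<psi> (j, t, False)"
      have \<alpha>: "\<alpha> \<in> S" "c1 \<alpha> = j" "c2 \<alpha> = t" "\<not> c3 \<alpha>"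
        using \<phi>\<psi>[OF j(1) t(1)] unfolding \<alpha>_def c1_def c2_def c3_def by auto
      have "u \<alpha> = w" "g \<alpha> = q t" using \<alpha> t(2) unfolding u_def w_def g_def by auto
      moreover have "\<alpha> = x \<or> (\<alpha>, x) \<in> R"
      proof (cases "t = y \<and> \<not> c3 x")
        case True
        then have "\<phi> \<alpha> = \<phi> x" using \<alpha> x unfolding \<phi> by simp
        then show ?thesis using inj \<alpha>(1) x(1) X(1) by (auto dest: inj_onD)
      next
        case False
        then show ?thesis using t(4) \<alpha> x X(1) unfolding R_iff by auto
      qed
      ultimately show ?thesis using \<alpha>(1) x(1) t(5) by auto
    qed
    ultimately show ?thesis by blast
  next
    case False
    define Z where "Z = c1 ` X"
    have ZS: "Z \<subseteq> S" using X c12 unfolding Z_def by auto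
    have "uncountable Z"
    proof
      assume "countable Z"
      then have "less_b (\<Union>j\<in>Z. {x \<in> X. c1 x = j})"
        by (rule less_b_UN_countable[where X="\<lambda>j. {x \<in> X. c1 x = j}"]) (use False ZS in blast)
      then have "less_b X" by (rule less_b_subset) (auto simp: Z_def)
      then show False using X(2) by simp
    qed
    then obtain j\<^sub>0 z where j0: "j\<^sub>0 \<in> Z" "z \<in> Z" "(j\<^sub>0, z) \<in> s" "infinite {y \<in> Z. (y, j\<^sub>0) \<in> s}"
        "countable {y \<in> Z. (y, j\<^sub>0) \<in> s}"
      using strict_wo_infinite_predecessors[OF wo ZS] by blast
    have j0S: "j\<^sub>0 \<in> S" using j0 ZS by blast
    define D where "D = (\<lambda>y. SOME x. x \<in> X \<and> c1 x = y) ` {y \<in> Z. (y, j\<^sub>0) \<in> s}"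
    have some: "(SOME x. x \<in> X \<and> c1 x = y) \<in> X \<and> c1 (SOME x. x \<in> X \<and> c1 x = y) = y" if "y \<in> Z" for y
      using that unfolding Z_def by (intro someI_ex[of "\<lambda>x. x \<in> X \<and> c1 x = y"]) auto
    have D: "D \<subseteq> X" "D \<subseteq> N j\<^sub>0" "countable D"
      using some X(1) j0(5) unfolding D_def N_def by auto
    have "infinite D"
    proof -
      have "{y \<in> Z. (y, j\<^sub>0) \<in> s} \<subseteq> c1 ` D" using some unfolding D_def by force
      then show ?thesis using j0(4) by (meson finite_imageI finite_subset)
    qed
    obtain v where v: "v \<in> \<C> j\<^sub>0" "D \<subseteq> v" using \<C>(2)[OF j0S] D unfolding covers_def by meson
    have "infinite (v \<inter> X)" using \<open>infinite D\<close> D(1) v(2) by (meson finite_subset le_inf_iff)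
    moreover have "\<exists>\<alpha>\<in>S. u \<alpha> = v \<and> (\<exists>\<beta>\<in>X. \<alpha> = \<beta> \<or> (\<alpha>, \<beta>) \<in> R) \<and>
          (\<exists>\<^sub>F n in sequentially. h n < g \<alpha> n)" for h
    proof -
      have "\<not> less_b T \<or> \<not> less_b S \<and> (\<forall>j\<in>S. \<exists>z\<in>Z. (j, z) \<in> s)"
      proof (rule ccontr)
        assume neg: "\<not> ?thesis"
        then have T: "less_b T" by blast
        \<comment> \<open>If the blocks that meet \<open>X\<close> are bounded, \<open>X\<close> injects into a set of the size of \<open>T\<close>.\<close>
        have "\<not> less_b S" using X less_b_subset by blast
        with neg obtain j where j: "j \<in> S" "\<forall>z\<in>Z. (j, z) \<notin> s" by blast
        have "X \<subseteq> {x \<in> S. c1 x \<in> {j} \<union> {i. (i, j) \<in> s}}"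
          using j X(1) c12(1) strict_wo_total[OF wo j(1)] unfolding Z_def by blast
        moreover have "|{x \<in> S. c1 x \<in> {j} \<union> {i. (i, j) \<in> s}}| \<le>o ?k"
        proof (rule small)
          show "|{j} \<union> {i. (i, j) \<in> s}| \<le>o ?k"
            using seg[OF j(1)] countable_ordLeq_infinite[of "{j}", OF _ k] k
            by (intro card_of_Un_ordLeq_infinite_Field) auto
        qed
        ultimately have "less_b X" using less_b_subset less_b_ordLeq[OF T] by blast
        then show False using X(2) by simp
      qed
      then obtain j z f where j: "j \<in> S" "j = j\<^sub>0 \<or> (j\<^sub>0, j) \<in> s" "z \<in> Z" "(j, z) \<in> s" "f \<in> \<Gamma> j"
          "\<exists>\<^sub>F n in sequentially. h n < f n"
        using \<Gamma>(2)[OF j0S ZS, of h] j0 by blast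
      have "v \<in> \<D> j" using v(1) j(2) unfolding \<D>_def by auto
      then have "(v, f) \<in> e j ` T" using e j(1,5) by auto
      then obtain t where t: "t \<in> T" "e j t = (v, f)" by auto
      obtain x where x: "x \<in> X" "c1 x = z" using j(3) unfolding Z_def by auto
      define \<alpha> where "\<alpha> = \<psi> (j, t, True)"
      have \<alpha>: "\<alpha> \<in> S" "c1 \<alpha> = j" "c2 \<alpha> = t" "c3 \<alpha>"
        using \<phi>\<psi>[OF j(1) t(1)] unfolding \<alpha>_def c1_def c2_def c3_def by auto
      have "u \<alpha> = v" "g \<alpha> = f" using \<alpha> t(2) unfolding u_def g_def by auto
      moreover have "(\<alpha>, x) \<in> R" using \<alpha> x X(1) j(4) unfolding R_iff by auto
      ultimately show ?thesis using \<alpha>(1) x(1) j(6) by auto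
    qed
    ultimately show ?thesis by blast
  qed
  have "guesses S R u g" unfolding guesses_def
    by (rule conjI; intro ballI allI impI) (rule ug main; assumption)+
  then show ?thesis using woR bd by (intro exI conjI)
qed

lemma ex_guesses:
  fixes k :: "'k rel" and S :: "'a set"
  assumes "is_aleph n k" "|S| \<le>o k"
  shows "\<exists>R u g. strict_wo S R \<and> guesses S R u g \<and>
    (uncountable S \<longrightarrow> (\<forall>D\<subseteq>S. countable D \<longrightarrow> (\<exists>\<beta>\<in>S. \<forall>d\<in>D. (d, \<beta>) \<in> R)))"
  using assms
proof (induction n arbitrary: k S)
  case 0
  then have "k =o natLeq" by simp
  with 0(2) have "|S| \<le>o natLeq" by (rule ordLeq_ordIso_trans)
  then have "countable S" by (simp add: countable_iff_natLeq)
  then have "less_b X" if "X \<subseteq> S" for X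
    using less_b_countable countable_subset that by blast
  then have "guesses S ( |S| - Id) (\<lambda>_. {}) (\<lambda>_ _. 0)"
    unfolding guesses_def by (simp add: mono_def)
  then show ?case
    using strict_wo_card_of(1)[of S] \<open>countable S\<close> by (intro exI conjI) auto
next
  case (Suc n)
  then obtain l :: "'k rel" where l: "is_aleph n l" "k =o cardSuc l" by auto
  note l' = is_aleph_Card_order[OF l(1)] is_aleph_infinite[OF l(1)]
  have Ssuc: "|S| \<le>o cardSuc l" using Suc.prems(2) l(2) by (rule ordLeq_ordIso_trans)
  show ?case
  proof (cases "|S| \<le>o l")
    case True
    then show ?thesis by (rule Suc.IH[OF l(1)])
  next
    case False
    then have "l \<le>o |S|"
      using l'(1) card_of_Well_order not_ordLeq_iff_ordLess ordLess_imp_ordLeq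
      unfolding card_order_on_def by blast
    then have "|Field l| \<le>o |S|"
      using card_of_Field_ordIso[OF l'(1)] ordIso_ordLeq_trans by blast
    then obtain i where i: "inj_on i (Field l)" "i ` Field l \<subseteq> S"
      unfolding card_of_ordLeq[symmetric] by blast
    define T where "T = i ` Field l"
    have "|Field l| =o |T|"
      using i(1) inj_on_imp_bij_betw card_of_ordIsoI unfolding T_def by blast
    then have Tl: "|T| =o l"
      using card_of_Field_ordIso[OF l'(1)] ordIso_symmetric ordIso_transitive by blast
    have T: "T \<subseteq> S" "infinite T" using i l'(2) unfolding T_def by (auto dest: finite_imageD)
    obtain r p q where T': "strict_wo T r" "guesses T r p q"
      using Suc.IH[OF l(1) ordIso_imp_ordLeq[OF Tl]] by (elim exE conjE)
    have "|{i. (i, j) \<in> |S| - Id}| \<le>o |T|" if "j \<in> S" for j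
      using strict_wo_cardSuc[OF l'(1) Ssuc that] ordIso_symmetric[OF Tl] by (rule ordLeq_ordIso_trans)
    moreover have "\<not> |S| \<le>o |T|" using False Tl ordLeq_ordIso_trans by blast
    moreover have "\<exists>\<C>. |\<C>| \<le>o |T| \<and> covers \<C> N" if "|N| \<le>o |T|" for N :: "'a set"
      using ex_small_cover[OF l(1) ordLeq_ordIso_trans[OF that Tl]]
        ordLeq_ordIso_trans[OF _ ordIso_symmetric[OF Tl]] by blast
    ultimately have "\<exists>R u g. strict_wo S R \<and> guesses S R u g \<and>
        (\<forall>D\<subseteq>S. countable D \<longrightarrow> (\<exists>\<beta>\<in>S. \<forall>d\<in>D. (d, \<beta>) \<in> R))"
      by (intro guesses_step[OF strict_wo_card_of(1) _ T _ T'])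
    then show ?thesis by (elim exE conjE) (intro exI conjI impI)
  qed
qed

section \<open>Positive sets of an almost disjoint family\<close>

definition ad :: "nat set set \<Rightarrow> bool" where
  "ad \<A> \<longleftrightarrow> pairwise (\<lambda>A B. finite (A \<inter> B)) \<A>"

lemma adD: "ad \<A> \<Longrightarrow> a \<in> \<A> \<Longrightarrow> b \<in> \<A> \<Longrightarrow> a \<noteq> b \<Longrightarrow> finite (a \<inter> b)"
  unfolding ad_def pairwise_def by simp

text \<open>
  Positive sets are the members of \<open>id_plus \<A>\<close>; the formulation avoids the generated ideal.
\<close>

definition pos :: "nat set set \<Rightarrow> nat set \<Rightarrow> bool" where
  "pos \<A> B \<longleftrightarrow> (\<forall>G. finite G \<and> G \<subseteq> \<A> \<longrightarrow> infinite (B - \<Union>G))"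

lemma posD: "pos \<A> B \<Longrightarrow> finite G \<Longrightarrow> G \<subseteq> \<A> \<Longrightarrow> infinite (B - \<Union>G)"
  unfolding pos_def by blast

lemma pos_infinite: "pos \<A> B \<Longrightarrow> infinite B"
  using posD[of \<A> B "{}"] by simp

lemma pos_mono: "pos \<A> B \<Longrightarrow> B \<subseteq> C \<Longrightarrow> pos \<A> C"
  unfolding pos_def by (meson Diff_mono finite_subset subset_refl)

lemma not_pos_Un:
  assumes "\<not> pos \<A> B" "\<not> pos \<A> C"
  shows "\<not> pos \<A> (B \<union> C)"
proof -
  obtain G H where "finite G" "G \<subseteq> \<A>" "finite (B - \<Union>G)" "finite H" "H \<subseteq> \<A>" "finite (C - \<Union>H)"
    using assms unfolding pos_def by blast
  then have "finite (G \<union> H)" "G \<union> H \<subseteq> \<A>" "finite ((B - \<Union>G) \<union> (C - \<Union>H))" by auto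
  moreover have "(B \<union> C) - \<Union>(G \<union> H) \<subseteq> (B - \<Union>G) \<union> (C - \<Union>H)" by blast
  ultimately show ?thesis using posD finite_subset by metis
qed

lemma not_pos_empty: "\<not> pos \<A> {}"
  using pos_infinite by blast

lemma not_pos_member: "a \<in> \<A> \<Longrightarrow> \<not> pos \<A> a"
  using posD[of \<A> a "{a}"] by auto

lemma pos_UN_finite:
  assumes "finite I" "pos \<A> (\<Union>i\<in>I. B i)"
  shows "\<exists>i\<in>I. pos \<A> (B i)"
  using assms
proof (induction I rule: finite_induct)
  case empty
  then show ?case by (simp add: not_pos_empty)
next
  case (insert i I)
  then show ?case using not_pos_Un[of \<A> "B i" "\<Union>i\<in>I. B i"] by auto
qed

lemma pos_Diff:
  assumes "pos \<A> B" "\<not> pos \<A> (B \<inter> C)"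
  shows "pos \<A> (B - C)"
proof (rule ccontr)
  assume "\<not> pos \<A> (B - C)"
  then have "\<not> pos \<A> ((B - C) \<union> (B \<inter> C))" using assms(2) by (rule not_pos_Un)
  moreover have "(B - C) \<union> (B \<inter> C) = B" by blast
  ultimately show False using assms(1) by simp
qed

text \<open>
  A finite union of members is almost disjoint from every other member.
\<close>

lemma pos_if_infinitely_many:
  assumes "ad \<A>" and inf: "infinite {a \<in> \<A>. infinite (a \<inter> B)}"
  shows "pos \<A> B"
  unfolding pos_def
proof (intro allI impI notI)
  fix G assume G: "finite G \<and> G \<subseteq> \<A>" and fin: "finite (B - \<Union>G)"
  obtain a where a: "a \<in> \<A>" "infinite (a \<inter> B)" "a \<notin> G"
    using inf G by (metis (mono_tags, lifting) finite_subset mem_Collect_eq subsetI)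
  have "finite (a \<inter> b)" if "b \<in> G" for b
    by (rule adD[OF assms(1) a(1)]) (use a that G in auto)
  then have "finite ((B - \<Union>G) \<union> (\<Union>b\<in>G. a \<inter> b))"
    using fin G by (intro finite_UnI finite_UN_I) auto
  moreover have "a \<inter> B \<subseteq> (B - \<Union>G) \<union> (\<Union>b\<in>G. a \<inter> b)" by blast
  ultimately show False using a(2) finite_subset by blast
qed

lemma pos_if_orthogonal:
  assumes "infinite B" "\<And>a. a \<in> \<A> \<Longrightarrow> finite (a \<inter> B)"
  shows "pos \<A> B"
  unfolding pos_def
proof (intro allI impI notI)
  fix G assume G: "finite G \<and> G \<subseteq> \<A>" and "finite (B - \<Union>G)"
  then have "finite ((B - \<Union>G) \<union> (\<Union>b\<in>G. b \<inter> B))"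
    using assms(2) by (intro finite_UnI finite_UN_I) auto
  moreover have "B \<subseteq> (B - \<Union>G) \<union> (\<Union>b\<in>G. b \<inter> B)" by blast
  ultimately show False using assms(1) finite_subset by blast
qed

lemma infinite_halves:
  assumes "infinite C"
  shows "\<exists>x\<subseteq>C. infinite x \<and> infinite (C - x)"
proof -
  obtain f :: "nat \<Rightarrow> 'a" where f: "inj f" "range f \<subseteq> C"
    using infinite_countable_subset[OF assms] by blast
  define x where "x = range (\<lambda>n. f (2 * n))"
  have "inj (\<lambda>n. f (2 * n))" "inj (\<lambda>n. f (2 * n + 1))"
    by (auto intro!: injI simp: inj_eq[OF f(1)])
  then have x: "infinite x" and y: "infinite (range (\<lambda>n. f (2 * n + 1)))"
    unfolding x_def using range_inj_infinite by blast+
  have "f (2 * m + 1) \<noteq> f (2 * n)" for m n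
    unfolding inj_eq[OF f(1)] by presburger
  then have "range (\<lambda>n. f (2 * n + 1)) \<subseteq> C - x" using f(2) unfolding x_def by auto
  then have "infinite (C - x)" using y finite_subset by auto
  moreover have "x \<subseteq> C" using f(2) unfolding x_def by auto
  ultimately show ?thesis using x by auto
qed

text \<open>
  Subtracting from each of countably many members the earlier ones removes only finitely many
  points.
\<close>

lemma disjoint_pieces:
  assumes "ad \<A>" "M \<subseteq> \<A>" "infinite M" and B: "\<forall>a\<in>M. infinite (a \<inter> B)"
  shows "\<exists>a z :: nat \<Rightarrow> nat set. inj a \<and> range a \<subseteq> M \<and> (\<forall>n. z n \<subseteq> a n \<inter> B) \<and>
    (\<forall>n. infinite (z n)) \<and> (\<forall>m n. m < n \<longrightarrow> a m \<inter> z n = {})"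
proof -
  obtain a :: "nat \<Rightarrow> nat set" where a: "inj a" "range a \<subseteq> M"
    using infinite_countable_subset[OF assms(3)] by blast
  define z where "z n = a n \<inter> B - (\<Union>m<n. a m)" for n
  have "infinite (z n)" for n
  proof
    assume "finite (z n)"
    moreover have "finite (a n \<inter> a m)" if "m < n" for m
    proof -
      have "a n \<noteq> a m" using a(1) that by (auto dest: injD)
      moreover have "a n \<in> \<A>" "a m \<in> \<A>" using a(2) assms(2) by blast+
      ultimately show ?thesis using adD[OF assms(1)] by simp
    qed
    ultimately have "finite (z n \<union> (\<Union>m<n. a n \<inter> a m))"
      by (intro finite_UnI finite_UN_I) auto
    moreover have "a n \<inter> B \<subseteq> z n \<union> (\<Union>m<n. a n \<inter> a m)" unfolding z_def by blast
    ultimately have "finite (a n \<inter> B)" by (rule rev_finite_subset)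
    then show False using B a(2) by blast
  qed
  then show ?thesis using a by (intro exI[of _ a] exI[of _ z]) (auto simp: z_def)
qed

text \<open>
  If infinitely many members meet \<open>B\<close> in an infinite set, distribute countably many of them
  alternately.  Otherwise remove the finitely many that do; what remains of \<open>B\<close> is almost disjoint
  from all members, and so are both halves of it.
\<close>

lemma pos_split:
  assumes ad: "ad \<A>" and B: "pos \<A> B"
  shows "\<exists>x. pos \<A> (B \<inter> x) \<and> pos \<A> (B - x)"
proof -
  define M where "M = {a \<in> \<A>. infinite (a \<inter> B)}"
  show ?thesis
  proof (cases "finite M")
    case True
    define C where "C = B - \<Union>M"
    have "infinite C" unfolding C_def using posD[OF B True] by (auto simp: M_def)
    then obtain x where x: "x \<subseteq> C" "infinite x" "infinite (C - x)"
      using infinite_halves by blast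
    have C: "finite (a \<inter> C)" if "a \<in> \<A>" for a
    proof (cases "a \<in> M")
      case True
      then have "a \<inter> C = {}" unfolding C_def by blast
      then show ?thesis by simp
    next
      case False
      then have "finite (a \<inter> B)" using that unfolding M_def by simp
      then show ?thesis by (rule rev_finite_subset) (auto simp: C_def)
    qed
    have "pos \<A> y" if "infinite y" "y \<subseteq> C" for y
      using that(1) by (rule pos_if_orthogonal) (use C that(2) in \<open>meson Int_mono finite_subset order_refl\<close>)
    then have "pos \<A> x" "pos \<A> (C - x)" using x by auto
    moreover have "x \<subseteq> B \<inter> x" "C - x \<subseteq> B - x" using x unfolding C_def by auto
    ultimately show ?thesis using pos_mono by blast
  next
    case False
    have "M \<subseteq> \<A>" "\<forall>a\<in>M. infinite (a \<inter> B)" unfolding M_def by auto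
    from disjoint_pieces[OF ad this(1) False this(2)]
    obtain a z :: "nat \<Rightarrow> nat set" where "inj a \<and> range a \<subseteq> M \<and> (\<forall>n. z n \<subseteq> a n \<inter> B) \<and>
      (\<forall>n. infinite (z n)) \<and> (\<forall>m n. m < n \<longrightarrow> a m \<inter> z n = {})" by (elim exE)
    then have az: "inj a" "range a \<subseteq> M"
      "\<And>n. z n \<subseteq> a n \<inter> B" "\<And>n. infinite (z n)" "\<And>m n. m < n \<Longrightarrow> a m \<inter> z n = {}"
      by simp_all
    define x where "x = (\<Union>n. z (2 * n))"
    have pos: "pos \<A> y" if i: "inj i" and y: "\<And>n. z (i n) \<subseteq> y" for i :: "nat \<Rightarrow> nat" and y
    proof (rule pos_if_infinitely_many[OF ad])
      have "inj (\<lambda>n. a (i n))" using inj_compose[OF az(1) i] by (simp add: comp_def)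
      then have "infinite (range (\<lambda>n. a (i n)))" by (rule range_inj_infinite)
      moreover have "infinite (a (i n) \<inter> y)" for n
      proof -
        have "z (i n) \<subseteq> a (i n) \<inter> y" using az(3) y by blast
        then show ?thesis using az(4) finite_subset by blast
      qed
      then have "range (\<lambda>n. a (i n)) \<subseteq> {a \<in> \<A>. infinite (a \<inter> y)}"
        using az(2) unfolding M_def by blast
      ultimately show "infinite {a \<in> \<A>. infinite (a \<inter> y)}" using finite_subset by blast
    qed
    have disj: "z m \<inter> z n = {}" if "m \<noteq> n" for m n
      using az(3,5) that by (metis Int_commute disjoint_iff linorder_neqE_nat le_infE subsetD)
    have "z (2 * n) \<subseteq> B \<inter> x" for n using az(3) unfolding x_def by blast
    then have "pos \<A> (B \<inter> x)" by (intro pos[of "\<lambda>n. 2 * n"]) (auto simp: inj_def)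
    moreover have "z (2 * n + 1) \<inter> z (2 * m) = {}" for n m by (rule disj) presburger
    then have "z (2 * n + 1) \<subseteq> B - x" for n using az(3) unfolding x_def by blast
    then have "pos \<A> (B - x)" by (intro pos[of "\<lambda>n. 2 * n + 1"]) (auto simp: inj_def)
    ultimately show ?thesis by blast
  qed
qed

lemma pseudointersection:
  fixes C :: "nat \<Rightarrow> nat set"
  assumes dec: "\<And>n. C (Suc n) \<subseteq> C n" and inf: "\<And>n. infinite (C n)"
  shows "\<exists>p\<subseteq>C 0. infinite p \<and> (\<forall>n. finite (p - C n))"
proof -
  have ex: "\<exists>x. x \<in> C n \<and> m < x" for n m using inf[of n] by (auto simp: infinite_nat_iff_unbounded)
  define f where "f = rec_nat (SOME x. x \<in> C 0) (\<lambda>n y. SOME x. x \<in> C (Suc n) \<and> y < x)"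
  have f0: "f 0 \<in> C 0" unfolding f_def using someI_ex[of "\<lambda>x. x \<in> C 0"] ex[of 0] by auto
  have fS: "f (Suc n) \<in> C (Suc n) \<and> f n < f (Suc n)" for n
    unfolding f_def using someI_ex[OF ex[of "Suc n"]] by simp
  have fC: "f n \<in> C n" for n using f0 fS by (cases n) auto
  have sm: "strict_mono f" using fS by (auto simp: strict_mono_Suc_iff)
  have le: "C n \<subseteq> C m" if "m \<le> n" for m n using dec that by (rule lift_Suc_antimono_le)
  have "range f - C n \<subseteq> f ` {..<n}" for n
  proof
    fix y assume "y \<in> range f - C n"
    then obtain k where k: "y = f k" "f k \<notin> C n" by blast
    then have "k < n" using fC[of k] le[of n k] by (metis not_less subsetD)
    then show "y \<in> f ` {..<n}" using k by blast
  qed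
  then have "finite (range f - C n)" for n using finite_subset by blast
  moreover have "infinite (range f)" using sm by (simp add: range_inj_infinite strict_mono_imp_inj_on)
  moreover have "range f \<subseteq> C 0" using fC le by blast
  ultimately show ?thesis by blast
qed

text \<open>
  Let \<open>M\<close> consist of the members that contain an infinite pseudo-intersection.  If \<open>M\<close> is finite,
  a pseudo-intersection of the sets \<open>B n - \<Union>M\<close> is almost disjoint from every member, since its
  intersection with a member would put that member into \<open>M\<close>.  If \<open>M\<close> is infinite, take
  pseudo-intersections \<open>p n\<close> inside countably many members and glue the sets \<open>p n \<inter> B n\<close>.
\<close>

lemma pos_pseudointersection:
  assumes ad: "ad \<A>" and dec: "\<And>n. B (Suc n) \<subseteq> B n" and B: "\<And>n. pos \<A> (B n)"
  shows "\<exists>e\<subseteq>B 0. pos \<A> e \<and> (\<forall>n. finite (e - B n))"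
proof -
  define ps where "ps p \<longleftrightarrow> infinite p \<and> p \<subseteq> B 0 \<and> (\<forall>n. finite (p - B n))" for p
  define M where "M = {a \<in> \<A>. \<exists>p\<subseteq>a. ps p}"
  show ?thesis
  proof (cases "finite M")
    case True
    have "infinite (B n - \<Union>M)" for n using posD[OF B True] by (auto simp: M_def)
    then obtain p where p: "p \<subseteq> B 0 - \<Union>M" "infinite p" "\<And>n. finite (p - (B n - \<Union>M))"
      using pseudointersection[of "\<lambda>n. B n - \<Union>M"] dec by (meson Diff_mono order_refl)
    have fin: "finite (p - B n)" for n
      using p(3)[of n] by (rule rev_finite_subset) blast
    have "pos \<A> p"
    proof (rule pos_if_orthogonal[OF p(2)], rule ccontr)
      fix a assume a: "a \<in> \<A>" "infinite (a \<inter> p)"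
      have "finite (a \<inter> p - B n)" for n using fin[of n] by (rule rev_finite_subset) blast
      then have "ps (a \<inter> p)" using a(2) p(1) unfolding ps_def by blast
      then have "a \<in> M" using a(1) unfolding M_def by blast
      then have "a \<inter> p = {}" using p(1) by blast
      then show False using a(2) by simp
    qed
    then show ?thesis using p(1) fin by blast
  next
    case False
    obtain a :: "nat \<Rightarrow> nat set" where a: "inj a" "range a \<subseteq> M"
      using infinite_countable_subset[OF False] by blast
    have "\<forall>n. \<exists>p. p \<subseteq> a n \<and> ps p" using a(2) unfolding M_def by blast
    then obtain p where p: "\<And>n. p n \<subseteq> a n" "\<And>n. ps (p n)" by metis
    define e where "e = (\<Union>n. p n \<inter> B n)"
    have le: "B n \<subseteq> B m" if "m \<le> n" for m n using dec that by (rule lift_Suc_antimono_le)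
    have "finite (e - B n)" for n
    proof -
      have "e - B n \<subseteq> (\<Union>k<n. p k - B n)"
      proof
        fix x assume "x \<in> e - B n"
        then obtain k where k: "x \<in> p k" "x \<in> B k" "x \<notin> B n" unfolding e_def by blast
        then have "k < n" using le[of n k] by (metis not_less subsetD)
        then show "x \<in> (\<Union>k<n. p k - B n)" using k by blast
      qed
      moreover have "finite (\<Union>k<n. p k - B n)" using p(2) unfolding ps_def by blast
      ultimately show ?thesis by (rule finite_subset)
    qed
    moreover have "pos \<A> e"
    proof (rule pos_if_infinitely_many[OF ad])
      have "infinite (a n \<inter> e)" for n
      proof
        assume "finite (a n \<inter> e)"
        moreover have "finite (p n - B n)" "infinite (p n)" using p(2) unfolding ps_def by auto
        moreover have "p n \<subseteq> (a n \<inter> e) \<union> (p n - B n)" using p(1) unfolding e_def by blast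
        ultimately show False by (meson finite_UnI finite_subset)
      qed
      then have "range a \<subseteq> {a \<in> \<A>. infinite (a \<inter> e)}" using a(2) unfolding M_def by blast
      then show "infinite {a \<in> \<A>. infinite (a \<inter> e)}"
        using range_inj_infinite[OF a(1)] finite_subset by blast
    qed
    moreover have "e \<subseteq> B 0" using le unfolding e_def by blast
    ultimately show ?thesis by blast
  qed
qed

text \<open>
  The standard proof that an infinite maximal almost disjoint family has at least \<open>b\<close> members:
  take one point from each of countably many disjoint pieces, beyond a function that dominates, for
  every other member, the function bounding its traces on the pieces.
\<close>

lemma ex_orthogonal:
  assumes ad: "ad \<A>" and e: "pos \<A> e" and small: "less_b {a \<in> \<A>. infinite (a \<inter> e)}"
  shows "\<exists>c\<subseteq>e. infinite c \<and> (\<forall>a\<in>\<A>. finite (a \<inter> c))"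
proof -
  define M where "M = {a \<in> \<A>. infinite (a \<inter> e)}"
  have other: "finite (a \<inter> c)" if "a \<in> \<A> - M" "c \<subseteq> e" for a c
  proof -
    have "finite (a \<inter> e)" using that unfolding M_def by blast
    then show ?thesis by (rule rev_finite_subset) (use that in blast)
  qed
  show ?thesis
  proof (cases "finite M")
    case True
    have "infinite (e - \<Union>M)" using posD[OF e True] by (auto simp: M_def)
    moreover have "finite (a \<inter> (e - \<Union>M))" if "a \<in> \<A>" for a
    proof (cases "a \<in> M")
      case True
      then have "a \<inter> (e - \<Union>M) = {}" by blast
      then show ?thesis by simp
    qed (use that in \<open>auto intro: other\<close>)
    ultimately show ?thesis by blast
  next
    case False
    have "M \<subseteq> \<A>" "\<forall>a\<in>M. infinite (a \<inter> e)" unfolding M_def by auto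
    from disjoint_pieces[OF ad this(1) False this(2)]
    obtain a z :: "nat \<Rightarrow> nat set" where "inj a \<and> range a \<subseteq> M \<and> (\<forall>n. z n \<subseteq> a n \<inter> e) \<and>
      (\<forall>n. infinite (z n)) \<and> (\<forall>m n. m < n \<longrightarrow> a m \<inter> z n = {})" by (elim exE)
    then have az: "inj a" "range a \<subseteq> M"
      "\<And>n. z n \<subseteq> a n \<inter> e" "\<And>n. infinite (z n)" "\<And>m n. m < n \<Longrightarrow> a m \<inter> z n = {}"
      by simp_all
    obtain h where h: "\<forall>b\<in>M. \<forall>\<^sub>F n in sequentially. Max (insert 0 (b \<inter> z n)) \<le> h n"
      using less_bD[OF small, of "\<lambda>b n. Max (insert 0 (b \<inter> z n))"] unfolding M_def by (rule exE)
    have "\<forall>n. \<exists>x. x \<in> z n \<and> max n (h n) < x"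
    proof
      fix n
      have "\<exists>x>max n (h n). x \<in> z n"
        using az(4)[of n] unfolding infinite_nat_iff_unbounded by (rule spec)
      then show "\<exists>x. x \<in> z n \<and> max n (h n) < x" by blast
    qed
    then obtain x where x: "\<And>n. x n \<in> z n" "\<And>n. max n (h n) < x n" by metis
    have "infinite (range x)"
    proof
      assume "finite (range x)"
      then obtain m where "\<And>n. x n \<le> m" by (auto simp: finite_nat_set_iff_bounded_le)
      then show False using x(2)[of m] by (metis max.strict_boundedE not_less)
    qed
    moreover have "range x \<subseteq> e" using x(1) az(3) by blast
    moreover have "finite (b \<inter> range x)" if b: "b \<in> M" for b
    proof -
      have "\<forall>\<^sub>F n in sequentially. x n \<notin> b"
      proof (cases "b \<in> range a")
        case True
        then obtain m where "b = a m" by blast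
        then have "x n \<notin> b" if "m < n" for n using az(5)[OF that] x(1) by blast
        then show ?thesis unfolding eventually_sequentially by (metis less_eq_Suc_le)
      next
        case False
        have no: "x n \<notin> b" if "Max (insert 0 (b \<inter> z n)) \<le> h n" for n
        proof
          assume "x n \<in> b"
          have "a n \<in> \<A>" "b \<in> \<A>" "a n \<noteq> b" using az(2) b False unfolding M_def by auto
          then have "finite (b \<inter> a n)" using adD[OF ad] by simp
          then have "finite (b \<inter> z n)" by (rule rev_finite_subset) (use az(3) in blast)
          then have "x n \<le> Max (insert 0 (b \<inter> z n))"
            using \<open>x n \<in> b\<close> x(1) by (intro Max_ge) auto
          then show False using that x(2)[of n] by simp
        qed
        show ?thesis by (rule eventually_mono[OF h[rule_format, OF b]]) (rule no)
      qed
      then obtain N where N: "\<And>n. n \<ge> N \<Longrightarrow> x n \<notin> b" unfolding eventually_sequentially by blast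
      have "b \<inter> range x \<subseteq> x ` {..<N}" using N by (auto simp: not_less[symmetric])
      then show ?thesis using finite_subset by blast
    qed
    ultimately show ?thesis using other by blast
  qed
qed

section \<open>The tree of nodes\<close>

text \<open>
  The elements of \<open>'l\<close> are the levels of the tree.  Level \<open>\<alpha>\<close> tests the points for membership in
  \<open>x \<alpha>\<close> and guesses the set \<open>u \<alpha>\<close> of lower levels and the function \<open>g \<alpha>\<close>.
\<close>

locale guessing_levels = wellorder le lt
  for le :: "'l \<Rightarrow> 'l \<Rightarrow> bool"  (infix \<open>\<sqsubseteq>\<close> 50) and lt :: "'l \<Rightarrow> 'l \<Rightarrow> bool"  (infix \<open>\<sqsubset>\<close> 50) +
  fixes x :: "'l \<Rightarrow> nat set" and u :: "'l \<Rightarrow> 'l set" and g :: "'l \<Rightarrow> nat \<Rightarrow> nat"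
  assumes surj_x: "surj x"
    and countable_u: "countable (u \<alpha>)"
    and u_below: "\<beta> \<in> u \<alpha> \<Longrightarrow> \<beta> \<sqsubset> \<alpha>"
    and mono_g: "m \<le> n \<Longrightarrow> g \<alpha> m \<le> g \<alpha> n"
    and bounded: "countable D \<Longrightarrow> \<exists>\<beta>. \<forall>\<delta>\<in>D. \<delta> \<sqsubset> \<beta>"
    and guess: "\<not> less_b X \<Longrightarrow> \<exists>v. infinite (v \<inter> X) \<and>
      (\<forall>h. \<exists>\<alpha>. u \<alpha> = v \<and> (\<exists>\<beta>\<in>X. \<alpha> \<sqsubseteq> \<beta>) \<and> (\<exists>\<^sub>F n in sequentially. h n < g \<alpha> n))"
begin

lemma ex_least:
  assumes "P \<alpha>"
  shows "\<exists>\<beta>. P \<beta> \<and> (\<forall>\<gamma>. \<gamma> \<sqsubset> \<beta> \<longrightarrow> \<not> P \<gamma>)"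
  using assms
proof (induction \<alpha> rule: less_induct)
  case (less \<alpha>)
  then show ?case by (cases "\<exists>\<gamma>. \<gamma> \<sqsubset> \<alpha> \<and> P \<gamma>") auto
qed

text \<open>
  For a fixed \<open>\<alpha>\<close>, the point \<open>m\<close> belongs to \<open>near \<alpha> Y\<close> if it is below the value of \<open>g \<alpha>\<close> at the
  first index of a \<open>\<beta>\<close> in \<open>u \<alpha>\<close> with \<open>m \<in> Y \<beta>\<close>; since \<open>g \<alpha>\<close> is monotone, demanding this for all such
  \<open>\<beta>\<close> amounts to the same.  So \<open>near \<alpha> Y\<close> is the region below the graph of \<open>g \<alpha>\<close> in the partition of
  \<open>caught \<alpha> Y\<close> obtained by making the sets \<open>Y \<beta>\<close> disjoint.
\<close>

definition caught :: "'l \<Rightarrow> ('l \<Rightarrow> nat set) \<Rightarrow> nat set" where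
  "caught \<alpha> Y = (\<Union>\<beta>\<in>u \<alpha>. Y \<beta>)"

definition near :: "'l \<Rightarrow> ('l \<Rightarrow> nat set) \<Rightarrow> nat set" where
  "near \<alpha> Y = {m \<in> caught \<alpha> Y. \<forall>\<beta>\<in>u \<alpha>. m \<in> Y \<beta> \<longrightarrow> m < g \<alpha> (to_nat_on (u \<alpha>) \<beta>)}"

definition color :: "'l \<Rightarrow> ('l \<Rightarrow> nat set) \<Rightarrow> nat \<Rightarrow> bool \<times> bool \<times> bool" where
  "color \<alpha> Y m = (m \<in> x \<alpha>, m \<in> caught \<alpha> Y, m \<in> near \<alpha> Y)"

definition agree :: "'l \<Rightarrow> ('l \<Rightarrow> nat set) \<Rightarrow> ('l \<Rightarrow> nat set) \<Rightarrow> bool" where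
  "agree \<xi> Y Y' \<longleftrightarrow> (\<forall>\<beta>. \<beta> \<sqsubset> \<xi> \<longrightarrow> Y \<beta> = Y' \<beta>)"

text \<open>
  A partial family is a set \<open>A\<close> of triples \<open>(a, \<xi>, Y)\<close>: the set \<open>a\<close> is tagged with the node \<open>(\<xi>, Y)\<close>,
  of which only the values of \<open>Y\<close> below \<open>\<xi>\<close> count.  In a coherent \<open>A\<close> at most one set is tagged with
  a given node, and the union merely extracts it, with \<open>{}\<close> as default.
\<close>

definition occupant :: "(nat set \<times> 'l \<times> ('l \<Rightarrow> nat set)) set \<Rightarrow> 'l \<Rightarrow> ('l \<Rightarrow> nat set) \<Rightarrow> nat set" where
  "occupant A \<alpha> Y = \<Union>{a. \<exists>Y'. (a, \<alpha>, Y') \<in> A \<and> agree \<alpha> Y' Y}"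

definition succs :: "(nat set \<times> 'l \<times> ('l \<Rightarrow> nat set)) set \<Rightarrow> 'l \<Rightarrow> ('l \<Rightarrow> nat set) \<Rightarrow> nat set set" where
  "succs A \<alpha> Y = range (\<lambda>i. {m. color \<alpha> Y m \<noteq> i} \<union> occupant A \<alpha> Y)"

definition path :: "(nat set \<times> 'l \<times> ('l \<Rightarrow> nat set)) set \<Rightarrow> 'l \<Rightarrow> ('l \<Rightarrow> nat set) \<Rightarrow> bool" where
  "path A \<xi> Y \<longleftrightarrow> (\<forall>\<beta>. \<beta> \<sqsubset> \<xi> \<longrightarrow> Y \<beta> \<in> succs A \<beta> Y)"

text \<open>
  The invariant of the recursion.  The paths refer to the occupants with respect to all of \<open>A\<close>,
  including those that are added later.
\<close>

definition coherent :: "(nat set \<times> 'l \<times> ('l \<Rightarrow> nat set)) set \<Rightarrow> bool" where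
  "coherent A \<longleftrightarrow>
    (\<forall>a \<xi> Y. (a, \<xi>, Y) \<in> A \<longrightarrow> infinite a \<and> path A \<xi> Y \<and> (\<forall>\<beta>. \<beta> \<sqsubset> \<xi> \<longrightarrow> finite (a \<inter> Y \<beta>))) \<and>
    (\<forall>s\<in>A. \<forall>t\<in>A. s \<noteq> t \<longrightarrow> finite (fst s \<inter> fst t)) \<and>
    (\<forall>a a' \<xi> Y Y'. (a, \<xi>, Y) \<in> A \<longrightarrow> (a', \<xi>, Y') \<in> A \<longrightarrow> agree \<xi> Y Y' \<longrightarrow> a = a')"

text \<open>
  A new tag must be free: placed below an old one, it would become an occupant on the path of the
  old one, whose discarded sets have been fixed without it.
\<close>

definition free :: "(nat set \<times> 'l \<times> ('l \<Rightarrow> nat set)) set \<Rightarrow> 'l \<Rightarrow> ('l \<Rightarrow> nat set) \<Rightarrow> bool" where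
  "free A \<xi> Y \<longleftrightarrow> \<not> (\<exists>a \<xi>' Y'. (a, \<xi>', Y') \<in> A \<and> \<xi> \<sqsubseteq> \<xi>' \<and> agree \<xi> Y' Y)"

definition admissible :: "(nat set \<times> 'l \<times> ('l \<Rightarrow> nat set)) set \<Rightarrow> nat set \<times> 'l \<times> ('l \<Rightarrow> nat set) \<Rightarrow> bool" where
  "admissible A = (\<lambda>(a, \<xi>, Y). infinite a \<and> (\<forall>t\<in>A. finite (fst t \<inter> a)) \<and>
    (\<forall>\<beta>. \<beta> \<sqsubset> \<xi> \<longrightarrow> finite (a \<inter> Y \<beta>)) \<and> path A \<xi> Y \<and> free A \<xi> Y)"

definition settled :: "(nat set \<times> 'l \<times> ('l \<Rightarrow> nat set)) set \<Rightarrow> nat set \<Rightarrow> 'l \<Rightarrow> ('l \<Rightarrow> nat set) \<Rightarrow> bool" where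
  "settled A B \<xi> Y \<longleftrightarrow> pos (fst ` A) B \<and> path A \<xi> Y \<and> (\<forall>\<beta>. \<beta> \<sqsubset> \<xi> \<longrightarrow> \<not> pos (fst ` A) (B \<inter> Y \<beta>))"

lemma agree_sym: "agree \<xi> Y Y' \<Longrightarrow> agree \<xi> Y' Y"
  unfolding agree_def by simp

lemma agree_trans: "agree \<xi> Y Y' \<Longrightarrow> agree \<xi> Y' Y'' \<Longrightarrow> agree \<xi> Y Y''"
  unfolding agree_def by simp

lemma agree_mono: "agree \<xi> Y Y' \<Longrightarrow> \<beta> \<sqsubseteq> \<xi> \<Longrightarrow> agree \<beta> Y Y'"
  unfolding agree_def using less_le_trans by blast

lemma color_cong: "agree \<alpha> Y Y' \<Longrightarrow> color \<alpha> Y = color \<alpha> Y'"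
proof -
  assume "agree \<alpha> Y Y'"
  then have "Y \<beta> = Y' \<beta>" if "\<beta> \<in> u \<alpha>" for \<beta> using u_below[OF that] unfolding agree_def by simp
  then show ?thesis unfolding color_def caught_def near_def by (simp add: fun_eq_iff)
qed

lemma occupant_cong: "agree \<alpha> Y Y' \<Longrightarrow> occupant A \<alpha> Y = occupant A \<alpha> Y'"
  unfolding occupant_def using agree_trans agree_sym by metis

lemma succs_cong: "agree \<alpha> Y Y' \<Longrightarrow> succs A \<alpha> Y = succs A \<alpha> Y'"
  unfolding succs_def by (simp add: color_cong occupant_cong)

lemma path_cong:
  assumes "agree \<xi> Y Y'"
  shows "path A \<xi> Y \<longleftrightarrow> path A \<xi> Y'"
proof -
  have "succs A \<beta> Y = succs A \<beta> Y'" "Y \<beta> = Y' \<beta>" if "\<beta> \<sqsubset> \<xi>" for \<beta>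
    using assms that succs_cong agree_mono less_imp_le by (auto simp: agree_def)
  then show ?thesis unfolding path_def by simp
qed

lemma coherent_triple:
  assumes "coherent A" "(a, \<xi>, Y) \<in> A"
  shows "infinite a" "path A \<xi> Y" "\<beta> \<sqsubset> \<xi> \<Longrightarrow> finite (a \<inter> Y \<beta>)"
  using assms(1)[unfolded coherent_def, THEN conjunct1, rule_format, OF assms(2)] by simp_all

lemma coherent_disjoint:
  assumes "coherent A" "s \<in> A" "t \<in> A" "s \<noteq> t"
  shows "finite (fst s \<inter> fst t)"
  using assms(1)[unfolded coherent_def, THEN conjunct2, THEN conjunct1, rule_format, OF assms(2-4)] .

lemma coherent_node:
  assumes "coherent A" "(a, \<xi>, Y) \<in> A" "(a', \<xi>, Y') \<in> A" "agree \<xi> Y Y'"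
  shows "a = a'"
  using assms(1)[unfolded coherent_def, THEN conjunct2, THEN conjunct2, rule_format, OF assms(2-4)] .

lemma coherent_ad:
  assumes "coherent A"
  shows "ad (fst ` A)"
  unfolding ad_def
proof (rule pairwiseI)
  fix a b assume "a \<in> fst ` A" "b \<in> fst ` A" "a \<noteq> b"
  then obtain s t where st: "s \<in> A" "t \<in> A" "a = fst s" "b = fst t" by (elim imageE) (rule that)
  then have "s \<noteq> t" using \<open>a \<noteq> b\<close> by auto
  then show "finite (a \<inter> b)" using coherent_disjoint[OF assms st(1,2)] st(3,4) by simp
qed

lemma not_pos_occupant:
  assumes "coherent A"
  shows "\<not> pos (fst ` A) (occupant A \<alpha> Y)"
proof (cases "\<exists>a Y'. (a, \<alpha>, Y') \<in> A \<and> agree \<alpha> Y' Y")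
  case True
  then obtain a Y' where a: "(a, \<alpha>, Y') \<in> A" "agree \<alpha> Y' Y" by blast
  have same: "a' = a''" if "(a', \<alpha>, Z) \<in> A" "(a'', \<alpha>, Z') \<in> A" "agree \<alpha> Z Z'" for a' a'' Z Z'
    using coherent_node[OF assms that] .
  have "a' = a" if "(a', \<alpha>, Z) \<in> A" "agree \<alpha> Z Y" for a' Z
    using same[OF that(1) a(1)] agree_trans[OF that(2) agree_sym[OF a(2)]] by blast
  then have "occupant A \<alpha> Y \<subseteq> a" unfolding occupant_def by blast
  moreover have "a \<in> fst ` A" using a(1) by force
  ultimately show ?thesis using not_pos_member pos_mono by blast
next
  case False
  then have "occupant A \<alpha> Y = {}" unfolding occupant_def by blast
  then show ?thesis by (simp add: not_pos_empty)
qed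

text \<open>
  Follow \<open>B\<close> upwards from \<open>\<xi>\<close>, choosing at each level a successor that meets \<open>B\<close> in a set that is not
  positive.  This must end at some level \<open>\<rho>\<close>: otherwise \<open>B\<close> would be almost homogeneous for
  membership in \<open>x \<beta>\<close> at every level \<open>\<beta>\<close>, also where \<open>x \<beta>\<close> splits \<open>B\<close> into two positive sets.  At
  \<open>\<rho>\<close> no color class contains \<open>B\<close> modulo a set that is not positive, so two color classes meet \<open>B\<close>
  in positive sets.
\<close>

lemma ex_splitting_level:
  assumes A: "coherent A" and B: "settled A B \<xi> Y"
  obtains \<rho> Z y\<^sub>0 y\<^sub>1 where "\<xi> \<sqsubseteq> \<rho>" "agree \<xi> Z Y" "settled A B \<rho> Z"
    "y\<^sub>0 \<in> succs A \<rho> Z" "y\<^sub>1 \<in> succs A \<rho> Z" "y\<^sub>0 \<noteq> y\<^sub>1"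
    "pos (fst ` A) (B - y\<^sub>0)" "pos (fst ` A) (B - y\<^sub>1)"
proof -
  let ?pos = "pos (fst ` A)"
  have posB: "?pos B" using B unfolding settled_def by blast
  define good where "good Z \<beta> y \<longleftrightarrow> y \<in> succs A \<beta> Z \<and> \<not> ?pos (B \<inter> y)" for Z \<beta> y
  define P where "P Z \<beta> y \<longleftrightarrow> (if \<beta> \<sqsubset> \<xi> then y = Y \<beta> else (\<exists>y. good Z \<beta> y) \<longrightarrow> good Z \<beta> y)" for Z \<beta> y
  \<comment> \<open>Where no successor is good, \<open>P\<close> leaves the value open, so that the recursion is total.\<close>
  have "\<exists>Z. \<forall>\<beta>. P Z \<beta> (Z \<beta>)"
  proof (rule dependent_wf_choice[where R="{(\<beta>, \<alpha>). \<beta> \<sqsubset> \<alpha>}"])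
    show "wf {(\<beta>, \<alpha>). \<beta> \<sqsubset> \<alpha>}" by (rule wf)
    fix Z Z' :: "'l \<Rightarrow> nat set" and \<alpha> and y assume "\<And>\<beta>. (\<beta>, \<alpha>) \<in> {(\<beta>, \<alpha>). \<beta> \<sqsubset> \<alpha>} \<Longrightarrow> Z \<beta> = Z' \<beta>"
    then have "agree \<alpha> Z Z'" unfolding agree_def by blast
    then show "P Z \<alpha> y = P Z' \<alpha> y" unfolding P_def good_def by (simp add: succs_cong)
  next
    fix \<alpha> and Z :: "'l \<Rightarrow> nat set"
    show "\<exists>y. P Z \<alpha> y" unfolding P_def by auto
  qed
  then obtain Z where Z: "\<And>\<beta>. P Z \<beta> (Z \<beta>)" by blast
  have ZY: "agree \<xi> Z Y" using Z unfolding P_def agree_def by metis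
  have below: "Z \<beta> \<in> succs A \<beta> Z \<and> \<not> ?pos (B \<inter> Z \<beta>)" if "\<beta> \<sqsubset> \<xi>" for \<beta>
  proof -
    have "path A \<xi> Z" using B path_cong[OF ZY] unfolding settled_def by blast
    then have "Z \<beta> \<in> succs A \<beta> Z" using that unfolding path_def by blast
    moreover have "Z \<beta> = Y \<beta>" using ZY that unfolding agree_def by blast
    then have "\<not> ?pos (B \<inter> Z \<beta>)" using B that unfolding settled_def by simp
    ultimately show ?thesis by (rule conjI)
  qed
  define bad where "bad \<beta> \<longleftrightarrow> \<not> \<beta> \<sqsubset> \<xi> \<and> \<not> (\<exists>y. good Z \<beta> y)" for \<beta>
  have notbad: "Z \<beta> \<in> succs A \<beta> Z \<and> \<not> ?pos (B \<inter> Z \<beta>)" if "\<not> bad \<beta>" for \<beta>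
  proof (cases "\<beta> \<sqsubset> \<xi>")
    case False
    then have "good Z \<beta> (Z \<beta>)" using that Z[of \<beta>] unfolding bad_def P_def by auto
    then show ?thesis unfolding good_def .
  qed (rule below)
  have "\<exists>\<beta>. bad \<beta>"
  proof (rule ccontr)
    assume none: "\<not> (\<exists>\<beta>. bad \<beta>)"
    obtain X where X: "?pos (B \<inter> X)" "?pos (B - X)" using pos_split[OF coherent_ad[OF A] posB] by blast
    obtain \<beta> where \<beta>: "x \<beta> = X" using surj_x by (metis surjD)
    have "Z \<beta> \<in> succs A \<beta> Z" "\<not> ?pos (B \<inter> Z \<beta>)" using notbad none by blast+
    then obtain i where "\<not> ?pos (B \<inter> ({m. color \<beta> Z m \<noteq> i} \<union> occupant A \<beta> Z))"
      unfolding succs_def by auto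
    then have *: "\<not> ?pos (B \<inter> {m. color \<beta> Z m \<noteq> i})" by (rule contrapos_nn) (erule pos_mono, blast)
    show False
    proof (cases "fst i")
      case True
      then have "B - X \<subseteq> B \<inter> {m. color \<beta> Z m \<noteq> i}" using \<beta> unfolding color_def by auto
      then show ?thesis using * X(2) pos_mono by blast
    next
      case False
      then have "B \<inter> X \<subseteq> B \<inter> {m. color \<beta> Z m \<noteq> i}" using \<beta> unfolding color_def by auto
      then show ?thesis using * X(1) pos_mono by blast
    qed
  qed
  then obtain \<rho> where bad: "bad \<rho>" and min: "\<And>\<beta>. \<beta> \<sqsubset> \<rho> \<Longrightarrow> \<not> bad \<beta>"
    using ex_least by blast
  have st: "settled A B \<rho> Z" unfolding settled_def path_def using posB notbad[OF min] by simp
  have "\<xi> \<sqsubseteq> \<rho>" using bad unfolding bad_def by (simp add: not_less)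
  define C where "C i = {m. color \<rho> Z m = i}" for i
  define y where "y i = {m. color \<rho> Z m \<noteq> i} \<union> occupant A \<rho> Z" for i
  have ys: "y i \<in> succs A \<rho> Z" for i unfolding y_def succs_def by blast
  then have "?pos (B \<inter> y i)" for i using bad unfolding bad_def good_def by blast
  then have pB: "?pos (B - C i)" for i
  proof -
    assume "\<And>i. ?pos (B \<inter> y i)"
    then have "?pos (B \<inter> y i)" .
    moreover have "B \<inter> y i \<subseteq> (B - C i) \<union> occupant A \<rho> Z" unfolding y_def C_def by blast
    ultimately show ?thesis using not_pos_Un not_pos_occupant[OF A] pos_mono by blast
  qed
  have sub: "\<exists>i\<in>I. ?pos (B \<inter> C i)" if "?pos (\<Union>i\<in>I. B \<inter> C i)" for I
    by (rule pos_UN_finite[OF _ that]) (rule finite)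
  have "B = (\<Union>i\<in>UNIV. B \<inter> C i)" unfolding C_def by auto
  then obtain i where i: "?pos (B \<inter> C i)" using sub[of UNIV] posB by auto
  have "B - C i = (\<Union>j\<in>-{i}. B \<inter> C j)" unfolding C_def by auto
  then obtain j where j: "j \<noteq> i" "?pos (B \<inter> C j)" using sub[of "-{i}"] pB[of i] by auto
  have py: "?pos (B - y k)" if "?pos (B \<inter> C k)" for k
  proof -
    have "\<not> ?pos (B \<inter> C k \<inter> occupant A \<rho> Z)" using not_pos_occupant[OF A] by (rule contrapos_nn) (erule pos_mono, blast)
    with that have "?pos (B \<inter> C k - occupant A \<rho> Z)" by (rule pos_Diff)
    moreover have "B \<inter> C k - occupant A \<rho> Z \<subseteq> B - y k" unfolding y_def C_def by blast
    ultimately show ?thesis by (rule pos_mono)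
  qed
  have "y i \<noteq> y j"
  proof
    assume "y i = y j"
    have "B - y i \<subseteq> y j" using j(1) unfolding y_def by auto
    then have empty: "B - y i = {}" using \<open>y i = y j\<close> by blast
    show False using py[OF i] not_pos_empty unfolding empty by (rule notE[rotated])
  qed
  then show thesis
    using that[OF \<open>\<xi> \<sqsubseteq> \<rho>\<close> ZY st ys ys _ py[OF i] py[OF j(2)]] by blast
qed

lemma settled_split:
  assumes A: "coherent A" and B: "settled A B \<xi> Y"
  shows "\<exists>\<xi>' B\<^sub>0 Y\<^sub>0 B\<^sub>1 Y\<^sub>1. \<xi> \<sqsubset> \<xi>' \<and> settled A B\<^sub>0 \<xi>' Y\<^sub>0 \<and> settled A B\<^sub>1 \<xi>' Y\<^sub>1 \<and> B\<^sub>0 \<subseteq> B \<and> B\<^sub>1 \<subseteq> B \<and>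
    agree \<xi> Y\<^sub>0 Y \<and> agree \<xi> Y\<^sub>1 Y \<and> \<not> agree \<xi>' Y\<^sub>0 Y\<^sub>1"
proof -
  obtain \<rho> Z y\<^sub>0 y\<^sub>1 where s: "\<xi> \<sqsubseteq> \<rho>" "agree \<xi> Z Y" "settled A B \<rho> Z"
    "y\<^sub>0 \<in> succs A \<rho> Z" "y\<^sub>1 \<in> succs A \<rho> Z" "y\<^sub>0 \<noteq> y\<^sub>1"
    "pos (fst ` A) (B - y\<^sub>0)" "pos (fst ` A) (B - y\<^sub>1)"
    using ex_splitting_level[OF A B] .
  have "\<exists>\<xi>'. \<rho> \<sqsubset> \<xi>'" using bounded[of "{\<rho>}"] by auto
  then obtain \<xi>' where \<rho>\<xi>': "\<rho> \<sqsubset> \<xi>'" and min: "\<And>\<beta>. \<beta> \<sqsubset> \<xi>' \<Longrightarrow> \<not> \<rho> \<sqsubset> \<beta>"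
    using ex_least[of "\<lambda>\<xi>'. \<rho> \<sqsubset> \<xi>'"] by blast
  have below: "\<beta> \<sqsubseteq> \<rho>" if "\<beta> \<sqsubset> \<xi>'" for \<beta>
    using min[OF that] by (simp add: not_less)
  have *: "settled A (B - y) \<xi>' (Z(\<rho> := y)) \<and> agree \<xi> (Z(\<rho> := y)) Y"
    if y: "y \<in> succs A \<rho> Z" "pos (fst ` A) (B - y)" for y
  proof -
    have ag: "agree \<rho> (Z(\<rho> := y)) Z" unfolding agree_def by auto
    have "path A \<xi>' (Z(\<rho> := y))"
      unfolding path_def
    proof (intro allI impI)
      fix \<beta> assume "\<beta> \<sqsubset> \<xi>'"
      then have "\<beta> \<sqsubseteq> \<rho>" by (rule below)
      then have "succs A \<beta> (Z(\<rho> := y)) = succs A \<beta> Z"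
        using succs_cong agree_mono[OF ag] by blast
      moreover have "\<beta> \<noteq> \<rho> \<Longrightarrow> Z \<beta> \<in> succs A \<beta> Z"
        using s(3) \<open>\<beta> \<sqsubseteq> \<rho>\<close> unfolding settled_def path_def by (simp add: le_neq_trans)
      ultimately show "(Z(\<rho> := y)) \<beta> \<in> succs A \<beta> (Z(\<rho> := y))" using y(1) by auto
    qed
    moreover have "\<not> pos (fst ` A) ((B - y) \<inter> (Z(\<rho> := y)) \<beta>)" if "\<beta> \<sqsubset> \<xi>'" for \<beta>
    proof (cases "\<beta> = \<rho>")
      case True
      then have "(B - y) \<inter> (Z(\<rho> := y)) \<beta> = {}" by auto
      then show ?thesis using not_pos_empty by metis
    next
      case False
      then have "\<not> pos (fst ` A) (B \<inter> Z \<beta>)"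
        using s(3) below[OF that] unfolding settled_def by (simp add: le_neq_trans)
      moreover have "(B - y) \<inter> (Z(\<rho> := y)) \<beta> \<subseteq> B \<inter> Z \<beta>" using False by auto
      ultimately show ?thesis using pos_mono by blast
    qed
    ultimately show ?thesis
      using y(2) agree_trans[OF agree_mono[OF ag s(1)] s(2)] unfolding settled_def by blast
  qed
  have "\<not> agree \<xi>' (Z(\<rho> := y\<^sub>0)) (Z(\<rho> := y\<^sub>1))"
    using s(6) \<rho>\<xi>' unfolding agree_def by (metis fun_upd_same)
  moreover have "\<xi> \<sqsubset> \<xi>'" using s(1) \<rho>\<xi>' by (rule le_less_trans)
  ultimately show ?thesis using *[OF s(4,7)] *[OF s(5,8)]
    by (intro exI[of _ \<xi>'] exI[of _ "B - y\<^sub>0"] exI[of _ "B - y\<^sub>1"]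
        exI[of _ "Z(\<rho> := y\<^sub>0)"] exI[of _ "Z(\<rho> := y\<^sub>1)"] conjI) auto
qed

section \<open>Continuum many nodes for a positive set\<close>

text \<open>
  The limit level \<open>\<eta>\<close> exists because countable sets of levels are bounded, and the limit set is a
  positive pseudo-intersection; it meets \<open>Z \<beta>\<close> in a set that is not positive since this holds for
  some \<open>B n\<close>, which almost contains it.
\<close>

lemma branch_limit:
  assumes A: "coherent A" and st: "\<And>n. settled A (B n) (\<xi> n) (Y n)"
    and B: "\<And>n. B (Suc n) \<subseteq> B n" and \<xi>: "\<And>n. \<xi> n \<sqsubset> \<xi> (Suc n)"
    and Y: "\<And>n. agree (\<xi> n) (Y (Suc n)) (Y n)"
  shows "\<exists>e \<eta> Z. settled A e \<eta> Z \<and> e \<subseteq> B 0 \<and> (\<forall>n. \<xi> n \<sqsubseteq> \<eta> \<and> agree (\<xi> n) Z (Y n))"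
proof -
  obtain \<eta>' where "\<forall>\<delta>\<in>range \<xi>. \<delta> \<sqsubset> \<eta>'" using bounded[of "range \<xi>"] by auto
  then have "\<exists>\<eta>. \<forall>n. \<xi> n \<sqsubseteq> \<eta>" by (intro exI[of _ \<eta>']) (simp add: less_imp_le)
  then obtain \<eta> where \<eta>: "\<And>n. \<xi> n \<sqsubseteq> \<eta>" and min: "\<And>\<gamma>. \<gamma> \<sqsubset> \<eta> \<Longrightarrow> \<not> (\<forall>n. \<xi> n \<sqsubseteq> \<gamma>)"
    using ex_least[of "\<lambda>\<eta>. \<forall>n. \<xi> n \<sqsubseteq> \<eta>"] by blast
  have mono: "\<xi> m \<sqsubseteq> \<xi> (m + k)" for m k
    by (induction k) (use \<xi> less_imp_le order_trans in auto)
  have ag: "agree (\<xi> m) (Y (m + k)) (Y m)" for m k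
  proof (induction k)
    case 0
    then show ?case by (simp add: agree_def)
  next
    case (Suc k)
    have "agree (\<xi> m) (Y (Suc (m + k))) (Y (m + k))" using agree_mono[OF Y mono] .
    then show ?case using agree_trans Suc by simp
  qed
  have ag': "Y m \<beta> = Y n \<beta>" if "\<beta> \<sqsubset> \<xi> m" "\<beta> \<sqsubset> \<xi> n" for m n \<beta>
  proof (cases "m \<le> n")
    case True
    then show ?thesis using ag[of m "n - m"] that(1) unfolding agree_def by simp
  next
    case False
    then show ?thesis using ag[of n "m - n"] that(2) unfolding agree_def by simp
  qed
  define N where "N \<beta> = (SOME n. \<beta> \<sqsubset> \<xi> n)" for \<beta>
  define Z where "Z \<beta> = Y (N \<beta>) \<beta>" for \<beta>
  have N: "\<beta> \<sqsubset> \<xi> (N \<beta>)" if "\<beta> \<sqsubset> \<xi> n" for \<beta> n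
    unfolding N_def using someI[of "\<lambda>n. \<beta> \<sqsubset> \<xi> n", OF that] .
  have Z: "agree (\<xi> n) Z (Y n)" for n
    unfolding agree_def Z_def using ag'[OF N] by blast
  have ex: "\<exists>n. \<beta> \<sqsubset> \<xi> n" if "\<beta> \<sqsubset> \<eta>" for \<beta>
    using min[OF that] by (auto simp: not_le)
  have posB: "\<And>n. pos (fst ` A) (B n)" using st unfolding settled_def by blast
  obtain e where e: "e \<subseteq> B 0" "pos (fst ` A) e" "\<And>n. finite (e - B n)"
    using pos_pseudointersection[OF coherent_ad[OF A], of B, OF B posB] by blast
  have "Z \<beta> \<in> succs A \<beta> Z \<and> \<not> pos (fst ` A) (e \<inter> Z \<beta>)" if b: "\<beta> \<sqsubset> \<eta>" for \<beta>
  proof -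
    obtain n where n: "\<beta> \<sqsubset> \<xi> n" using ex[OF b] by blast
    then have "Y n \<beta> \<in> succs A \<beta> (Y n)" and np: "\<not> pos (fst ` A) (B n \<inter> Y n \<beta>)"
      using st[of n] unfolding settled_def path_def by blast+
    moreover have eq: "Z \<beta> = Y n \<beta>" using Z n unfolding agree_def by blast
    moreover have "succs A \<beta> Z = succs A \<beta> (Y n)"
      using succs_cong[OF agree_mono[OF Z less_imp_le[OF n]]] .
    ultimately have 1: "Z \<beta> \<in> succs A \<beta> Z" by simp
    have "\<not> pos (fst ` A) (e - B n)" using e(3)[of n] pos_infinite by blast
    then have "\<not> pos (fst ` A) ((e - B n) \<union> (B n \<inter> Y n \<beta>))" using np by (rule not_pos_Un)
    moreover have "e \<inter> Z \<beta> \<subseteq> (e - B n) \<union> (B n \<inter> Y n \<beta>)" unfolding eq by blast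
    ultimately have "\<not> pos (fst ` A) (e \<inter> Z \<beta>)" using pos_mono by blast
    with 1 show ?thesis by (rule conjI)
  qed
  then have "settled A e \<eta> Z" using e(2) unfolding settled_def path_def by blast
  then show ?thesis using e(1) \<eta> Z by (intro exI conjI allI)
qed

lemma ex_continuum_many_nodes:
  assumes A: "coherent A" and B: "pos (fst ` A) B"
  shows "\<exists>E \<Xi> Z. \<forall>f :: nat \<Rightarrow> bool. settled A (E f) (\<Xi> f) (Z f) \<and> E f \<subseteq> B \<and>
    (\<forall>f'. f \<noteq> f' \<longrightarrow> (\<exists>\<rho>. \<rho> \<sqsubset> \<Xi> f \<and> \<rho> \<sqsubset> \<Xi> f' \<and> Z f \<rho> \<noteq> Z f' \<rho>))"
proof -
  define ok where "ok s \<longleftrightarrow> settled A (fst s) (fst (snd s)) (snd (snd s))" for s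
  define R where "R s t\<^sub>0 t\<^sub>1 \<longleftrightarrow> (\<forall>t\<in>{t\<^sub>0, t\<^sub>1}. ok t \<and> fst t \<subseteq> fst s \<and>
      fst (snd s) \<sqsubset> fst (snd t) \<and> agree (fst (snd s)) (snd (snd t)) (snd (snd s))) \<and>
    (\<exists>\<rho>. \<rho> \<sqsubset> fst (snd t\<^sub>0) \<and> \<rho> \<sqsubset> fst (snd t\<^sub>1) \<and> snd (snd t\<^sub>0) \<rho> \<noteq> snd (snd t\<^sub>1) \<rho>)" for s t\<^sub>0 t\<^sub>1
  have "\<exists>t. ok s \<longrightarrow> R s (fst t) (snd t)" for s
  proof (cases "ok s")
    case True
    obtain \<xi>' B\<^sub>0 Y\<^sub>0 B\<^sub>1 Y\<^sub>1 where "fst (snd s) \<sqsubset> \<xi>' \<and> settled A B\<^sub>0 \<xi>' Y\<^sub>0 \<and> settled A B\<^sub>1 \<xi>' Y\<^sub>1 \<and>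
        B\<^sub>0 \<subseteq> fst s \<and> B\<^sub>1 \<subseteq> fst s \<and> agree (fst (snd s)) Y\<^sub>0 (snd (snd s)) \<and>
        agree (fst (snd s)) Y\<^sub>1 (snd (snd s)) \<and> \<not> agree \<xi>' Y\<^sub>0 Y\<^sub>1"
      using settled_split[OF A True[unfolded ok_def]] by (elim exE)
    then have "R s (B\<^sub>0, \<xi>', Y\<^sub>0) (B\<^sub>1, \<xi>', Y\<^sub>1)" unfolding R_def ok_def agree_def by simp
    then show ?thesis by (intro exI[of _ "((B\<^sub>0, \<xi>', Y\<^sub>0), (B\<^sub>1, \<xi>', Y\<^sub>1))"]) simp
  qed simp
  then obtain S where S: "\<And>s. ok s \<Longrightarrow> R s (fst (S s)) (snd (S s))" by metis
  define S' where "S' s b = (if b then snd (S s) else fst (S s))" for s and b :: bool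
  have S': "ok (S' s b)" "fst (S' s b) \<subseteq> fst s" "fst (snd s) \<sqsubset> fst (snd (S' s b))"
    "agree (fst (snd s)) (snd (snd (S' s b))) (snd (snd s))" if "ok s" for s b
    using S[OF that] unfolding R_def S'_def by auto
  have S'_split: "\<exists>\<rho>. \<rho> \<sqsubset> fst (snd (S' s b)) \<and> \<rho> \<sqsubset> fst (snd (S' s b')) \<and>
      snd (snd (S' s b)) \<rho> \<noteq> snd (snd (S' s b')) \<rho>" if "ok s" "b \<noteq> b'" for s b b'
    using S[OF that(1)] that(2) unfolding R_def S'_def by (cases b; cases b') fastforce+
  obtain \<xi>\<^sub>0 where \<xi>\<^sub>0: "\<And>\<beta>. \<not> \<beta> \<sqsubset> \<xi>\<^sub>0" using ex_least[of "\<lambda>_. True"] by blast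
  define s\<^sub>0 where "s\<^sub>0 = (B, \<xi>\<^sub>0, \<lambda>_ :: 'l. {} :: nat set)"
  have ok0: "ok s\<^sub>0" using B \<xi>\<^sub>0 unfolding ok_def s\<^sub>0_def settled_def path_def by simp
  define T where "T f = rec_nat s\<^sub>0 (\<lambda>n s. S' s (f n))" for f :: "nat \<Rightarrow> bool"
  have T0: "T f 0 = s\<^sub>0" and TS: "T f (Suc n) = S' (T f n) (f n)" for f n unfolding T_def by simp_all
  have okT: "ok (T f n)" for f n by (induction n) (simp_all add: T0 TS ok0 S'(1))
  have "\<exists>e \<eta> Z. settled A e \<eta> Z \<and> e \<subseteq> fst (T f 0) \<and>
      (\<forall>n. fst (snd (T f n)) \<sqsubseteq> \<eta> \<and> agree (fst (snd (T f n))) Z (snd (snd (T f n))))" for f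
    by (rule branch_limit[OF A okT[unfolded ok_def]]) (use S' okT in \<open>simp_all add: TS\<close>)
  then have "\<exists>t. settled A (fst t) (fst (snd t)) (snd (snd t)) \<and> fst t \<subseteq> B \<and>
      (\<forall>n. fst (snd (T f n)) \<sqsubseteq> fst (snd t) \<and> agree (fst (snd (T f n))) (snd (snd t)) (snd (snd (T f n))))" for f
    unfolding T0 s\<^sub>0_def by simp
  then obtain t where t: "\<And>f. settled A (fst (t f)) (fst (snd (t f))) (snd (snd (t f)))" "\<And>f. fst (t f) \<subseteq> B"
      "\<And>f n. fst (snd (T f n)) \<sqsubseteq> fst (snd (t f))"
      "\<And>f n. agree (fst (snd (T f n))) (snd (snd (t f))) (snd (snd (T f n)))"
    by metis
  have "\<exists>\<rho>. \<rho> \<sqsubset> fst (snd (t f)) \<and> \<rho> \<sqsubset> fst (snd (t f')) \<and> snd (snd (t f)) \<rho> \<noteq> snd (snd (t f')) \<rho>"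
    if ne: "f \<noteq> f'" for f f'
  proof -
    define n where "n = (LEAST n. f n \<noteq> f' n)"
    have "\<exists>n. f n \<noteq> f' n" using ne by blast
    then have n: "f n \<noteq> f' n" unfolding n_def by (rule wellorder_class.LeastI_ex)
    have lt: "f k = f' k" if "k < n" for k using wellorder_class.not_less_Least that unfolding n_def by blast
    have "k \<le> n \<Longrightarrow> T f k = T f' k" for k by (induction k) (simp_all add: T0 TS lt)
    then have eq: "T f n = T f' n" by simp
    obtain \<rho> where \<rho>: "\<rho> \<sqsubset> fst (snd (T f (Suc n)))" "\<rho> \<sqsubset> fst (snd (T f' (Suc n)))"
        "snd (snd (T f (Suc n))) \<rho> \<noteq> snd (snd (T f' (Suc n))) \<rho>"
      using S'_split[OF okT n, of f n] unfolding TS eq by auto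
    moreover have "snd (snd (t f)) \<rho> = snd (snd (T f (Suc n))) \<rho>"
      "snd (snd (t f')) \<rho> = snd (snd (T f' (Suc n))) \<rho>"
      using t(4) \<rho>(1,2) unfolding agree_def by blast+
    ultimately show ?thesis using less_le_trans[OF _ t(3)] by metis
  qed
  then show ?thesis using t(1,2)
    by (intro exI[of _ "\<lambda>f. fst (t f)"] exI[of _ "\<lambda>f. fst (snd (t f))"] exI[of _ "\<lambda>f. snd (snd (t f))"]) auto
qed

text \<open>
  Two of the nodes differ at a common level below both, so no tag extends both of them; if all were
  extended by tags, there would be continuum many tags.
\<close>

lemma ex_free_node:
  assumes A: "coherent A" and B: "pos (fst ` A) B" and small: "|A| <o |UNIV :: nat set set|"
  shows "\<exists>e \<xi> Y. settled A e \<xi> Y \<and> e \<subseteq> B \<and> free A \<xi> Y"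
proof (rule ccontr)
  assume none: "\<not> ?thesis"
  obtain E \<Xi> Z where EZ: "\<forall>f :: nat \<Rightarrow> bool. settled A (E f) (\<Xi> f) (Z f) \<and> E f \<subseteq> B \<and>
    (\<forall>f'. f \<noteq> f' \<longrightarrow> (\<exists>\<rho>. \<rho> \<sqsubset> \<Xi> f \<and> \<rho> \<sqsubset> \<Xi> f' \<and> Z f \<rho> \<noteq> Z f' \<rho>))"
    using ex_continuum_many_nodes[OF A B] by (elim exE)
  have "\<not> free A (\<Xi> f) (Z f)" for f using none EZ by blast
  then have "\<exists>t. t \<in> A \<and> \<Xi> f \<sqsubseteq> fst (snd t) \<and> agree (\<Xi> f) (snd (snd t)) (Z f)" for f
    unfolding free_def by force
  then obtain t where t: "\<And>f. t f \<in> A" "\<And>f. \<Xi> f \<sqsubseteq> fst (snd (t f))" "\<And>f. agree (\<Xi> f) (snd (snd (t f))) (Z f)"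
    by metis
  have "inj t"
  proof (rule injI, rule ccontr)
    fix f f' assume eq: "t f = t f'" and "f \<noteq> f'"
    then obtain \<rho> where \<rho>: "\<rho> \<sqsubset> \<Xi> f" "\<rho> \<sqsubset> \<Xi> f'" "Z f \<rho> \<noteq> Z f' \<rho>" using EZ by blast
    then have "snd (snd (t f)) \<rho> = Z f \<rho>" "snd (snd (t f')) \<rho> = Z f' \<rho>"
      using t(3) unfolding agree_def by blast+
    then show False using eq \<rho>(3) by simp
  qed
  then have "inj (\<lambda>X. t (\<lambda>n. n \<in> X))" by (auto intro!: injI dest!: injD simp: fun_eq_iff)
  then have "|UNIV :: nat set set| \<le>o |A|" by (rule card_of_ordLeqI) (use t(1) in auto)
  then show False using small not_ordLess_ordLeq by blast
qed

section \<open>Few members meet a set settled at a free node\<close>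

text \<open>
  Let \<open>\<beta>\<close> be the first level below \<open>\<xi>\<close> at which the tag of \<open>a\<close> ends or differs from \<open>Y\<close>; it exists
  because the node is free.  If the tag ends there, \<open>a\<close> is an occupant and thus a subset of \<open>Y \<beta>\<close>.
  If it differs from \<open>Y\<close>, then \<open>a\<close> is almost contained in another color class than the one
  kept by \<open>Y \<beta>\<close>.
\<close>

lemma departure_level:
  assumes A: "coherent A" and st: "settled A e \<xi> Y" and fr: "free A \<xi> Y" and a: "a \<in> fst ` A"
  shows "\<exists>\<beta>. \<beta> \<sqsubset> \<xi> \<and> finite (a - Y \<beta>)"
proof -
  obtain \<xi>' Y' where t: "(a, \<xi>', Y') \<in> A" using a by force
  define dep where "dep \<beta> \<longleftrightarrow> \<beta> \<sqsubset> \<xi> \<and> (\<beta> = \<xi>' \<or> \<beta> \<sqsubset> \<xi>' \<and> Y' \<beta> \<noteq> Y \<beta>)" for \<beta>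
  have "\<exists>\<beta>. dep \<beta>"
  proof (rule ccontr)
    assume none: "\<not> (\<exists>\<beta>. dep \<beta>)"
    then have "\<not> \<xi>' \<sqsubset> \<xi>" unfolding dep_def by blast
    then have le: "\<xi> \<sqsubseteq> \<xi>'" by (simp add: not_less)
    then have "agree \<xi> Y' Y"
      using none less_le_trans[OF _ le] unfolding dep_def agree_def by blast
    then show False using fr t le unfolding free_def by blast
  qed
  then obtain \<beta> where \<beta>: "dep \<beta>" and min: "\<And>\<gamma>. \<gamma> \<sqsubset> \<beta> \<Longrightarrow> \<not> dep \<gamma>"
    using ex_least[of dep] by blast
  have \<beta>\<xi>: "\<beta> \<sqsubset> \<xi>" using \<beta> unfolding dep_def by blast
  have le: "\<beta> \<sqsubseteq> \<xi>'" using \<beta> less_imp_le unfolding dep_def by auto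
  have ag: "agree \<beta> Y' Y"
    unfolding agree_def
  proof (intro allI impI)
    fix \<gamma> assume "\<gamma> \<sqsubset> \<beta>"
    then show "Y' \<gamma> = Y \<gamma>"
      using min less_trans[OF _ \<beta>\<xi>] less_le_trans[OF _ le] unfolding dep_def by blast
  qed
  have "Y \<beta> \<in> succs A \<beta> Y" using st \<beta>\<xi> unfolding settled_def path_def by blast
  then obtain j where j: "Y \<beta> = {m. color \<beta> Y m \<noteq> j} \<union> occupant A \<beta> Y" unfolding succs_def by blast
  have "finite (a - Y \<beta>)"
  proof (cases "\<beta> = \<xi>'")
    case True
    then have "a \<subseteq> occupant A \<beta> Y" using t ag unfolding occupant_def by blast
    then have "a - Y \<beta> = {}" using j by blast
    then show ?thesis by (simp only: finite.emptyI)
  next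
    case False
    then have lt: "\<beta> \<sqsubset> \<xi>'" and ne: "Y' \<beta> \<noteq> Y \<beta>" using \<beta> unfolding dep_def by auto
    have "Y' \<beta> \<in> succs A \<beta> Y'" using coherent_triple(2)[OF A t] lt unfolding path_def by blast
    then obtain i where i: "Y' \<beta> = {m. color \<beta> Y m \<noteq> i} \<union> occupant A \<beta> Y"
      unfolding succs_cong[OF ag] by (auto simp: succs_def)
    then have "i \<noteq> j" using ne j by auto
    then have "a - Y \<beta> \<subseteq> a \<inter> Y' \<beta>" unfolding i j by auto
    then show ?thesis using coherent_triple(3)[OF A t lt] finite_subset by blast
  qed
  then show ?thesis using \<beta>\<xi> by blast
qed

text \<open>
  Suppose that the set \<open>F\<close> of members that meet \<open>e\<close> in an infinite set has at least \<open>b\<close> elements.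
  Sending each to a level of departure is finite-to-one on \<open>F\<close>, so these levels
  are guessed by some \<open>v\<close>.  As \<open>e\<close> is settled, it is contained in one color class of each level below
  \<open>\<xi>\<close>, up to a set that is not positive.
  
  Let \<open>W\<close> be the union of the \<open>Y \<beta>\<close> with \<open>\<beta> \<in> v\<close>.  Infinitely many members of \<open>F\<close> depart at a level in
  \<open>v\<close>, so \<open>e \<inter> W\<close> is positive, and hence \<open>e - W\<close> is not.  Therefore all but
  countably many members of \<open>F\<close> are almost contained in \<open>W\<close> within \<open>e\<close> and almost disjoint there from
  each single \<open>Y \<beta>\<close>.  Choose countably many of these, \<open>b 0, b 1, \<dots>\<close>.  Each \<open>b k\<close> has, for each \<open>n\<close>, a
  point \<open>\<mu> k n\<close> that avoids the first \<open>n\<close> of the \<open>Y \<beta>\<close>.  If \<open>g \<alpha>\<close> exceeds the sum of the \<open>\<mu> k n\<close> with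
  \<open>k \<le> n\<close> for infinitely many \<open>n\<close>, all \<open>b k\<close> have infinitely many points in \<open>e \<inter> near \<alpha> Y\<close>, which
  is therefore positive.  But \<open>e - near \<alpha> Y\<close> is positive as well, because \<open>near \<alpha> Y\<close> has only
  finitely many points in each \<open>Y \<beta>\<close> with \<open>\<beta> \<in> v\<close>.
\<close>

lemma settled_meets_few:
  assumes A: "coherent A" and st: "settled A e \<xi> Y" and fr: "free A \<xi> Y"
  shows "less_b {a \<in> fst ` A. infinite (a \<inter> e)}"
proof (rule ccontr)
  let ?\<A> = "fst ` A"
  let ?pos = "pos (fst ` A)"
  define F where "F = {a \<in> ?\<A>. infinite (a \<inter> e)}"
  assume "\<not> less_b {a \<in> ?\<A>. infinite (a \<inter> e)}"
  then have F: "\<not> less_b F" unfolding F_def .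
  have many: "?pos B" if "infinite {a \<in> ?\<A>. infinite (a \<inter> B)}" for B
    using pos_if_infinitely_many[OF coherent_ad[OF A] that] .
  have few: "finite {a \<in> ?\<A>. infinite (a \<inter> B)}" if "\<not> ?pos B" for B
    using many that by blast
  have "\<forall>a\<in>?\<A>. \<exists>\<beta>. \<beta> \<sqsubset> \<xi> \<and> finite (a - Y \<beta>)" using departure_level[OF A st fr] by blast
  then obtain lev where lev: "\<And>a. a \<in> ?\<A> \<Longrightarrow> lev a \<sqsubset> \<xi>" "\<And>a. a \<in> ?\<A> \<Longrightarrow> finite (a - Y (lev a))"
    by metis
  have negY: "\<not> ?pos (e \<inter> Y \<beta>)" if "\<beta> \<sqsubset> \<xi>" for \<beta> using st that unfolding settled_def by blast
  have onY: "infinite (a \<inter> (e \<inter> Y (lev a)))" if "a \<in> F" for a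
  proof
    assume "finite (a \<inter> (e \<inter> Y (lev a)))"
    then have "finite ((a \<inter> (e \<inter> Y (lev a))) \<union> (a - Y (lev a)))" using lev(2) that F_def by auto
    then have "finite (a \<inter> e)" by (rule rev_finite_subset) blast
    then show False using that unfolding F_def by blast
  qed
  have "\<not> less_b (lev ` F)"
  proof
    assume "less_b (lev ` F)"
    then have "less_b F"
    proof (rule less_b_finite_to_one)
      fix \<beta>
      show "finite {a \<in> F. lev a = \<beta>}"
      proof (cases "\<beta> \<sqsubset> \<xi>")
        case True
        have "{a \<in> F. lev a = \<beta>} \<subseteq> {a \<in> ?\<A>. infinite (a \<inter> (e \<inter> Y \<beta>))}"
          using onY unfolding F_def by auto
        then show ?thesis using few[OF negY[OF True]] finite_subset by blast
      next
        case False
        then have "{a \<in> F. lev a = \<beta>} = {}" using lev(1) unfolding F_def by auto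
        then show ?thesis by (simp only: finite.emptyI)
      qed
    qed
    then show False using F by simp
  qed
  from guess[OF this] obtain v where "infinite (v \<inter> lev ` F) \<and>
      (\<forall>h. \<exists>\<alpha>. u \<alpha> = v \<and> (\<exists>\<beta>\<in>lev ` F. \<alpha> \<sqsubseteq> \<beta>) \<and> (\<exists>\<^sub>F n in sequentially. h n < g \<alpha> n))"
    by (rule exE)
  note v = this[THEN conjunct1] and guessv = this[THEN conjunct2, rule_format]
  have guess': "\<exists>\<alpha>. u \<alpha> = v \<and> \<alpha> \<sqsubset> \<xi> \<and> (\<exists>\<^sub>F n in sequentially. h n < g \<alpha> n)" for h
    using guessv[of h] lev(1) le_less_trans unfolding F_def by blast
  have undecided: "\<not> ?pos (e - C)" if "\<alpha> \<sqsubset> \<xi>" "C = {m. color \<alpha> Y m = i}" "Y \<alpha> = {m. color \<alpha> Y m \<noteq> i} \<union> occupant A \<alpha> Y" for \<alpha> C i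
  proof -
    have "e - C \<subseteq> e \<inter> Y \<alpha>" using that(2,3) by blast
    then show ?thesis using negY[OF that(1)] pos_mono by blast
  qed
  have decided: "\<exists>i. \<not> ?pos (e - {m. color \<alpha> Y m = i})" if "\<alpha> \<sqsubset> \<xi>" for \<alpha>
  proof -
    have "Y \<alpha> \<in> succs A \<alpha> Y" using st that unfolding settled_def path_def by blast
    then show ?thesis unfolding succs_def using undecided[OF that refl] by blast
  qed
  define K where "K = {a \<in> F. lev a \<in> v}"
  have "v \<inter> lev ` F \<subseteq> lev ` K" unfolding K_def by blast
  then have K: "infinite K" using v finite_subset finite_imageI by metis
  define W where "W = (\<Union>\<beta>\<in>v. Y \<beta>)"
  have posW: "?pos (e \<inter> W)"
  proof (rule many)
    have "K \<subseteq> {a \<in> ?\<A>. infinite (a \<inter> (e \<inter> W))}"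
    proof
      fix a assume a: "a \<in> K"
      then have "a \<inter> (e \<inter> Y (lev a)) \<subseteq> a \<inter> (e \<inter> W)" unfolding K_def W_def by blast
      then have "infinite (a \<inter> (e \<inter> W))" using onY[of a] a finite_subset unfolding K_def by blast
      then show "a \<in> {a \<in> ?\<A>. infinite (a \<inter> (e \<inter> W))}" using a unfolding K_def F_def by blast
    qed
    then show "infinite {a \<in> ?\<A>. infinite (a \<inter> (e \<inter> W))}" using K finite_subset by blast
  qed
  obtain \<alpha>\<^sub>0 where \<alpha>\<^sub>0: "u \<alpha>\<^sub>0 = v" "\<alpha>\<^sub>0 \<sqsubset> \<xi>" using guess'[of "\<lambda>_. 0"] by blast
  have cv: "countable v" using countable_u[of \<alpha>\<^sub>0] \<alpha>\<^sub>0(1) by simp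
  have v\<xi>: "\<beta> \<sqsubset> \<xi>" if "\<beta> \<in> v" for \<beta> using u_below[of \<beta> \<alpha>\<^sub>0] \<alpha>\<^sub>0 that less_trans by blast
  have negW: "\<not> ?pos (e - W)"
  proof -
    obtain i where i: "\<not> ?pos (e - {m. color \<alpha>\<^sub>0 Y m = i})" using decided[OF \<alpha>\<^sub>0(2)] by blast
    have W: "caught \<alpha>\<^sub>0 Y = W" unfolding caught_def W_def \<alpha>\<^sub>0(1) by simp
    show ?thesis
    proof (cases "fst (snd i)")
      case True
      then have "e - W \<subseteq> e - {m. color \<alpha>\<^sub>0 Y m = i}" unfolding color_def W by auto
      then show ?thesis using i pos_mono by blast
    next
      case False
      then have "e \<inter> W \<subseteq> e - {m. color \<alpha>\<^sub>0 Y m = i}" unfolding color_def W by auto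
      then show ?thesis using i posW pos_mono by blast
    qed
  qed
  \<comment> \<open>The countably many members of \<open>F\<close> that do not behave as required.\<close>
  define E where "E = {a \<in> ?\<A>. infinite (a \<inter> (e - W))} \<union> (\<Union>\<beta>\<in>v. {a \<in> ?\<A>. infinite (a \<inter> (e \<inter> Y \<beta>))})"
  have "countable E"
    unfolding E_def using few[OF negW] few[OF negY[OF v\<xi>]] cv
    by (intro countable_Un countable_UN) (auto intro: countable_finite)
  moreover have "uncountable F" using F less_b_countable by blast
  ultimately have "infinite (F - E)" by (metis countable_finite uncountable_minus_countable)
  then obtain b :: "nat \<Rightarrow> nat set" where b: "inj b" "range b \<subseteq> F - E"
    using infinite_countable_subset by blast
  have bF: "b k \<in> ?\<A>" "infinite (b k \<inter> e)" "finite (b k \<inter> (e - W))" for k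
    using b(2) unfolding F_def E_def by blast+
  have bY: "finite (b k \<inter> (e \<inter> Y \<beta>))" if "\<beta> \<in> v" for k \<beta>
    using b(2) that unfolding F_def E_def by blast
  let ?i = "to_nat_on v"
  have "\<exists>m. m \<in> b k \<inter> e \<inter> W \<and> n \<le> m \<and> (\<forall>\<beta>\<in>v. ?i \<beta> < n \<longrightarrow> m \<notin> Y \<beta>)" for k n
  proof -
    define V where "V = {\<beta> \<in> v. ?i \<beta> < n}"
    have "?i ` V \<subseteq> {..<n}" unfolding V_def by auto
    then have "finite (?i ` V)" by (rule finite_subset) simp
    moreover have "inj_on ?i V"
      using inj_on_to_nat_on[OF cv] by (rule inj_on_subset) (auto simp: V_def)
    ultimately have finV: "finite V" by (rule finite_imageD)
    define Q where "Q = (b k \<inter> (e - W)) \<union> (\<Union>\<beta>\<in>V. b k \<inter> (e \<inter> Y \<beta>)) \<union> {..<n}"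
    have "finite Q"
      unfolding Q_def using bF(3)[of k] finV bY by (intro finite_UnI finite_UN_I) (auto simp: V_def)
    then have "infinite (b k \<inter> e - Q)" using bF(2)[of k] by simp
    then obtain m where "m \<in> b k \<inter> e - Q" by (metis finite.emptyI ex_in_conv)
    then show ?thesis unfolding Q_def V_def by (intro exI[of _ m]) auto
  qed
  then obtain \<mu> where \<mu>: "\<And>k n. \<mu> k n \<in> b k \<inter> e \<inter> W" "\<And>k n. n \<le> \<mu> k n"
      "\<And>k n \<beta>. \<beta> \<in> v \<Longrightarrow> ?i \<beta> < n \<Longrightarrow> \<mu> k n \<notin> Y \<beta>"
    by metis
  define h where "h n = (\<Sum>k\<le>n. \<mu> k n)" for n
  have \<mu>h: "\<mu> k n \<le> h n" if "k \<le> n" for k n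
    unfolding h_def by (rule member_le_sum[of k _ "\<lambda>k. \<mu> k n"]) (use that in auto)
  obtain \<alpha> where \<alpha>: "u \<alpha> = v" "\<alpha> \<sqsubset> \<xi>" and freq: "\<exists>\<^sub>F n in sequentially. h n < g \<alpha> n"
    using guess'[of h] by blast
  have near: "near \<alpha> Y = {m \<in> W. \<forall>\<beta>\<in>v. m \<in> Y \<beta> \<longrightarrow> m < g \<alpha> (?i \<beta>)}"
    unfolding near_def caught_def W_def \<alpha>(1) ..
  have \<mu>near: "\<mu> k n \<in> near \<alpha> Y" if "h n < g \<alpha> n" "k \<le> n" for k n
  proof -
    have "\<mu> k n < g \<alpha> (?i \<beta>)" if "\<beta> \<in> v" "\<mu> k n \<in> Y \<beta>" for \<beta>
    proof -
      have "n \<le> ?i \<beta>" using \<mu>(3)[OF that(1), of n k] that(2) by (cases "?i \<beta> < n") auto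
      then have "g \<alpha> n \<le> g \<alpha> (?i \<beta>)" by (rule mono_g)
      then show ?thesis using \<open>h n < g \<alpha> n\<close> \<mu>h[OF \<open>k \<le> n\<close>] by linarith
    qed
    then show ?thesis using \<mu>(1) unfolding near by blast
  qed
  have "infinite (b k \<inter> (e \<inter> near \<alpha> Y))" for k
    unfolding infinite_nat_iff_unbounded_le
  proof
    fix m
    obtain n where n: "n \<ge> m + k" "h n < g \<alpha> n"
      using freq unfolding frequently_sequentially by blast
    have "\<mu> k n \<in> b k \<inter> (e \<inter> near \<alpha> Y)" using \<mu>(1) \<mu>near[OF n(2)] n(1) by auto
    moreover have "m \<le> \<mu> k n" using \<mu>(2)[of n k] n(1) by linarith
    ultimately show "\<exists>n\<ge>m. n \<in> b k \<inter> (e \<inter> near \<alpha> Y)" by blast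
  qed
  then have "range b \<subseteq> {a \<in> ?\<A>. infinite (a \<inter> (e \<inter> near \<alpha> Y))}" using bF(1) by blast
  then have pos_near: "?pos (e \<inter> near \<alpha> Y)"
    using range_inj_infinite[OF b(1)] by (intro many) (rule infinite_super)
  have "K \<subseteq> {a \<in> ?\<A>. infinite (a \<inter> (e - near \<alpha> Y))}"
  proof
    fix a assume a: "a \<in> K"
    have "infinite (a \<inter> (e - near \<alpha> Y))"
    proof
      assume "finite (a \<inter> (e - near \<alpha> Y))"
      then have "finite ((a \<inter> (e - near \<alpha> Y)) \<union> {..<g \<alpha> (?i (lev a))})" by simp
      moreover have "a \<inter> (e \<inter> Y (lev a)) \<subseteq> (a \<inter> (e - near \<alpha> Y)) \<union> {..<g \<alpha> (?i (lev a))}"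
        using a unfolding near K_def by auto
      ultimately have "finite (a \<inter> (e \<inter> Y (lev a)))" by (rule rev_finite_subset)
      then show False using onY a unfolding K_def by blast
    qed
    then show "a \<in> {a \<in> ?\<A>. infinite (a \<inter> (e - near \<alpha> Y))}" using a unfolding K_def F_def by blast
  qed
  then have pos_far: "?pos (e - near \<alpha> Y)" using K by (intro many) (rule infinite_super)
  obtain i where i: "\<not> ?pos (e - {m. color \<alpha> Y m = i})" using decided[OF \<alpha>(2)] by blast
  show False
  proof (cases "snd (snd i)")
    case True
    then have "e - near \<alpha> Y \<subseteq> e - {m. color \<alpha> Y m = i}" unfolding color_def by auto
    then show False using i pos_far pos_mono by blast
  next
    case False
    then have "e \<inter> near \<alpha> Y \<subseteq> e - {m. color \<alpha> Y m = i}" unfolding color_def by auto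
    then show False using i pos_near pos_mono by blast
  qed
qed

section \<open>The recursion\<close>

text \<open>
  The occupants seen by a triple when it is added never change afterwards, because later
  triples have nodes that were free and so do not lie below its own.
\<close>

lemma coherent_chain:
  fixes f :: "'s \<Rightarrow> (nat set \<times> 'l \<times> ('l \<Rightarrow> nat set)) set"
  assumes tot: "total_on D R" and down: "\<And>C C'. C \<in> D \<Longrightarrow> (C', C) \<in> R \<Longrightarrow> C' \<in> D"
    and adm: "\<And>C t. C \<in> D \<Longrightarrow> t \<in> f C \<Longrightarrow> admissible (\<Union>C'\<in>{C'. (C', C) \<in> R}. f C') t"
    and single: "\<And>C s t. C \<in> D \<Longrightarrow> s \<in> f C \<Longrightarrow> t \<in> f C \<Longrightarrow> s = t"
  shows "coherent (\<Union>C\<in>D. f C)"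
proof -
  let ?A = "\<Union>C\<in>D. f C"
  define A where "A C = (\<Union>C'\<in>{C'. (C', C) \<in> R}. f C')" for C
  have ad: "infinite a" "\<And>t. t \<in> A C \<Longrightarrow> finite (fst t \<inter> a)" "\<And>\<beta>. \<beta> \<sqsubset> \<xi> \<Longrightarrow> finite (a \<inter> Y \<beta>)"
    "path (A C) \<xi> Y" "\<And>a' \<xi>' Y'. (a', \<xi>', Y') \<in> A C \<Longrightarrow> \<xi> \<sqsubseteq> \<xi>' \<Longrightarrow> \<not> agree \<xi> Y' Y"
    if "C \<in> D" "(a, \<xi>, Y) \<in> f C" for C a \<xi> Y
    using adm[OF that] unfolding admissible_def A_def[symmetric] free_def by auto
  have occ: "occupant ?A \<beta> Y = occupant (A C) \<beta> Y" if C: "C \<in> D" "(a, \<xi>, Y) \<in> f C" "\<beta> \<sqsubset> \<xi>" for C a \<xi> Y \<beta>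
  proof -
    have "(a', \<beta>, Y') \<in> ?A \<and> agree \<beta> Y' Y \<longleftrightarrow> (a', \<beta>, Y') \<in> A C \<and> agree \<beta> Y' Y" for a' Y'
    proof
      assume *: "(a', \<beta>, Y') \<in> A C \<and> agree \<beta> Y' Y"
      then show "(a', \<beta>, Y') \<in> ?A \<and> agree \<beta> Y' Y" using down[OF C(1)] unfolding A_def by blast
    next
      assume *: "(a', \<beta>, Y') \<in> ?A \<and> agree \<beta> Y' Y"
      then obtain C' where C': "C' \<in> D" "(a', \<beta>, Y') \<in> f C'" by blast
      consider "C' = C" | "(C', C) \<in> R" | "(C, C') \<in> R" using tot C(1) C'(1) unfolding total_on_def by blast
      then show "(a', \<beta>, Y') \<in> A C \<and> agree \<beta> Y' Y"
      proof cases
        case 1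
        then have "(a', \<beta>, Y') = (a, \<xi>, Y)" using single[OF C(1) _ C(2)] C'(2) by blast
        then show ?thesis using C(3) by simp
      next
        case 2
        then show ?thesis using C'(2) * unfolding A_def by blast
      next
        case 3
        then have "(a, \<xi>, Y) \<in> A C'" using C(2) unfolding A_def by blast
        from ad(5)[OF C' this less_imp_le[OF C(3)]] show ?thesis using * agree_sym by blast
      qed
    qed
    then show ?thesis unfolding occupant_def by simp
  qed
  have disj: "finite (fst s \<inter> fst t)" if "C \<in> D" "C' \<in> D" "s \<in> f C" "t \<in> f C'" "(C', C) \<in> R" for C C' s t
  proof -
    have "t \<in> A C" using that(4,5) unfolding A_def by blast
    then have "finite (fst t \<inter> fst s)"
      using ad(2)[of C "fst s" "fst (snd s)" "snd (snd s)" t] that(1,3) by simp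
    then show ?thesis by (simp add: Int_commute)
  qed
  show ?thesis
    unfolding coherent_def
  proof (intro conjI allI ballI impI)
    fix a \<xi> Y assume "(a, \<xi>, Y) \<in> ?A"
    then obtain C where C: "C \<in> D" "(a, \<xi>, Y) \<in> f C" by blast
    show "infinite a" by (rule ad(1)[OF C])
    show "finite (a \<inter> Y \<beta>)" if "\<beta> \<sqsubset> \<xi>" for \<beta> by (rule ad(3)[OF C that])
    have "succs ?A \<beta> Y = succs (A C) \<beta> Y" if "\<beta> \<sqsubset> \<xi>" for \<beta>
      unfolding succs_def occ[OF C that] ..
    then show "path ?A \<xi> Y" using ad(4)[OF C] unfolding path_def by simp
  next
    fix s t assume "s \<in> ?A" "t \<in> ?A" and ne: "s \<noteq> t"
    then obtain C C' where C: "C \<in> D" "s \<in> f C" "C' \<in> D" "t \<in> f C'" by blast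
    then have "C \<noteq> C'" using single ne by blast
    then consider "(C', C) \<in> R" | "(C, C') \<in> R" using tot C unfolding total_on_def by blast
    then show "finite (fst s \<inter> fst t)"
      using disj[OF C(1,3,2,4)] disj[OF C(3,1,4,2)] by cases (auto simp: Int_commute)
  next
    fix a a' \<xi> Y Y' assume "(a, \<xi>, Y) \<in> ?A" "(a', \<xi>, Y') \<in> ?A" and agr: "agree \<xi> Y Y'"
    then obtain C C' where C: "C \<in> D" "(a, \<xi>, Y) \<in> f C" "C' \<in> D" "(a', \<xi>, Y') \<in> f C'" by blast
    have "\<not> (C', C) \<in> R"
      using ad(5)[OF C(1,2), of a' \<xi> Y'] agree_sym[OF agr] C(4) unfolding A_def by blast
    moreover have "\<not> (C, C') \<in> R"
      using ad(5)[OF C(3,4), of a \<xi> Y] agr C(2) unfolding A_def by blast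
    ultimately have "C = C'" using tot C unfolding total_on_def by blast
    then show "a = a'" using single[OF C(1,2)] C(4) by blast
  qed
qed

text \<open>
  A set \<open>c \<subseteq> e\<close> that is almost disjoint from all members is almost disjoint from the \<open>Y \<beta>\<close> too, since
  finitely many members almost cover \<open>e \<inter> Y \<beta>\<close>.
\<close>

lemma ex_admissible:
  assumes A: "coherent A" and B: "pos (fst ` A) B" and small: "|A| <o |UNIV :: nat set set|"
    and J: "\<And>C. infinite C \<Longrightarrow> \<exists>a\<in>J. infinite a \<and> a \<subseteq> C"
  shows "\<exists>t. admissible A t \<and> fst t \<subseteq> B \<and> fst t \<in> J"
proof -
  obtain e \<xi> Y where e: "settled A e \<xi> Y" "e \<subseteq> B" "free A \<xi> Y"
    using ex_free_node[OF A B small] by blast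
  have pe: "pos (fst ` A) e" using e(1) unfolding settled_def by blast
  obtain c where c: "c \<subseteq> e" "infinite c" "\<forall>a\<in>fst ` A. finite (a \<inter> c)"
    using ex_orthogonal[OF coherent_ad[OF A] pe settled_meets_few[OF A e(1,3)]] by blast
  obtain a where a: "a \<in> J" "infinite a" "a \<subseteq> c" using J[OF c(2)] by blast
  have "finite (fst t \<inter> a)" if "t \<in> A" for t
  proof -
    have "finite (fst t \<inter> c)" using c(3) that by blast
    then show ?thesis by (rule rev_finite_subset) (use a(3) in blast)
  qed
  moreover have "finite (a \<inter> Y \<beta>)" if b: "\<beta> \<sqsubset> \<xi>" for \<beta>
  proof -
    have "\<not> pos (fst ` A) (e \<inter> Y \<beta>)" using e(1) b unfolding settled_def by blast
    then obtain G where G: "finite G" "G \<subseteq> fst ` A" "finite (e \<inter> Y \<beta> - \<Union>G)" unfolding pos_def by blast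
    have "finite (\<Union>b\<in>G. b \<inter> c)" using G(1,2) c(3) by (intro finite_UN_I) auto
    with G(3) have "finite ((e \<inter> Y \<beta> - \<Union>G) \<union> (\<Union>b\<in>G. b \<inter> c))" by (rule finite_UnI)
    then show ?thesis by (rule rev_finite_subset) (use a(3) c(1) in blast)
  qed
  moreover have "path A \<xi> Y" using e(1) unfolding settled_def by blast
  ultimately have "admissible A (a, \<xi>, Y)" using a(2) e(3) unfolding admissible_def by simp
  then show ?thesis using a c e(2) by (intro exI[of _ "(a, \<xi>, Y)"]) auto
qed

lemma ex_ad_family:
  assumes J: "\<And>C. infinite C \<Longrightarrow> \<exists>a\<in>J. infinite a \<and> a \<subseteq> C"
  shows "\<exists>\<A>\<subseteq>J. ad \<A> \<and> (\<forall>a\<in>\<A>. infinite a) \<and> (\<forall>B. pos \<A> B \<longrightarrow> (\<exists>a\<in>\<A>. a \<subseteq> B))"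
proof -
  define R where "R = |UNIV :: nat set set| - Id"
  have wo: "strict_wo UNIV R" and seg: "\<And>B. |{C. (C, B) \<in> R}| <o |UNIV :: nat set set|"
    unfolding R_def by (simp_all only: strict_wo_card_of UNIV_I)
  define below where "below f B = (\<Union>C\<in>{C. (C, B) \<in> R}. f C)"
    for f :: "nat set \<Rightarrow> (nat set \<times> 'l \<times> ('l \<Rightarrow> nat set)) set" and B
  \<comment> \<open>Stage \<open>B\<close> adds at most one triple, so that fewer than continuum many precede each stage.\<close>
  define P where "P f B r \<longleftrightarrow> (if pos (fst ` below f B) B
      then \<exists>t. r = {t} \<and> admissible (below f B) t \<and> fst t \<subseteq> B \<and> fst t \<in> J else r = {})" for f B r
  have tot: "total_on D R" for D
    using wo unfolding strict_wo_def total_on_def by simp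
  have single: "s = t" if "P f B (f B)" "s \<in> f B" "t \<in> f B" for f B s t
    using that unfolding P_def by (auto split: if_splits)
  have adm: "admissible (below f B) t" "fst t \<in> J" if "P f B (f B)" "t \<in> f B" for f B t
    using that unfolding P_def by (auto split: if_splits)
  have coh: "coherent (\<Union>C\<in>D. f C)"
    if P: "\<And>C. C \<in> D \<Longrightarrow> P f C (f C)" and down: "\<And>C C'. C \<in> D \<Longrightarrow> (C', C) \<in> R \<Longrightarrow> C' \<in> D" for D f
    by (rule coherent_chain[OF tot down])
      (use single[OF P] adm(1)[OF P, unfolded below_def] in blast)+
  have "\<exists>f. \<forall>B. P f B (f B)"
  proof (rule dependent_wf_choice[where R=R])
    show "wf R" using wo unfolding strict_wo_def by blast
    fix f g :: "nat set \<Rightarrow> (nat set \<times> 'l \<times> ('l \<Rightarrow> nat set)) set" and B r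
    assume "\<And>C. (C, B) \<in> R \<Longrightarrow> f C = g C"
    then have "below f B = below g B" unfolding below_def by auto
    then show "P f B r = P g B r" unfolding P_def by simp
  next
    fix B and f :: "nat set \<Rightarrow> (nat set \<times> 'l \<times> ('l \<Rightarrow> nat set)) set"
    assume P: "\<And>C. (C, B) \<in> R \<Longrightarrow> P f C (f C)"
    have A: "coherent (below f B)"
      unfolding below_def using P strict_wo_trans[OF wo] by (intro coh) auto
    have "below f B \<subseteq> (\<lambda>C. the_elem (f C)) ` {C. (C, B) \<in> R}"
    proof
      fix t assume "t \<in> below f B"
      then obtain C where C: "(C, B) \<in> R" "t \<in> f C" unfolding below_def by blast
      then have "f C = {t}" using single[OF P[OF C(1)]] by blast
      then show "t \<in> (\<lambda>C. the_elem (f C)) ` {C. (C, B) \<in> R}" using C(1) by (auto intro!: image_eqI[of _ _ C])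
    qed
    then have "|below f B| \<le>o |(\<lambda>C. the_elem (f C)) ` {C. (C, B) \<in> R}|" by (rule card_of_mono1)
    also have "|(\<lambda>C. the_elem (f C)) ` {C. (C, B) \<in> R}| \<le>o |{C. (C, B) \<in> R}|" by (rule card_of_image)
    also note seg
    finally have small: "|below f B| <o |UNIV :: nat set set|" .
    show "\<exists>r. P f B r"
    proof (cases "pos (fst ` below f B) B")
      case True
      then obtain t where "admissible (below f B) t \<and> fst t \<subseteq> B \<and> fst t \<in> J"
        using ex_admissible[OF A True small J] by blast
      then show ?thesis using True unfolding P_def by (intro exI[of _ "{t}"]) simp
    next
      case False
      then show ?thesis unfolding P_def by simp
    qed
  qed
  then obtain f where f: "\<And>B. P f B (f B)" by blast
  define A where "A = (\<Union>C. f C)"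
  have A: "coherent A" unfolding A_def using f by (intro coh) auto
  have "fst ` A \<subseteq> J" using adm(2)[OF f] unfolding A_def by blast
  moreover have "infinite a" if "a \<in> fst ` A" for a
    using that coherent_triple(1)[OF A] by force
  moreover have "\<exists>a\<in>fst ` A. a \<subseteq> B" if pos: "pos (fst ` A) B" for B
  proof -
    have "below f B \<subseteq> A" unfolding below_def A_def by blast
    then have "pos (fst ` below f B) B" using pos unfolding pos_def by (meson image_mono subset_trans)
    then obtain t where "f B = {t}" "fst t \<subseteq> B" using f[of B] unfolding P_def by auto
    then show ?thesis unfolding A_def by blast
  qed
  ultimately show ?thesis using coherent_ad[OF A] by blast
qed

end

section \<open>Saturated families inside a dense family\<close>

lemma mem_id_gen:
  assumes G: "finite G" "G \<subseteq> \<A>" and fin: "finite (B - \<Union>G)"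
  shows "B \<in> id_gen \<A>"
  unfolding id_gen_def hull_def
proof (rule InterI, clarify)
  fix I assume I: "ideal_of_sets I" and sub: "\<A> \<union> {F. finite F} \<subseteq> I"
  have un: "X \<union> Z \<in> I" if "X \<in> I" "Z \<in> I" for X Z
    using I that unfolding ideal_of_sets_def by blast
  have "\<Union>G \<in> I" using G
  proof (induction G rule: finite_induct)
    case empty
    then show ?case using I unfolding ideal_of_sets_def by simp
  next
    case (insert a G)
    then show ?case using un[of a "\<Union>G"] sub by auto
  qed
  moreover have "B - \<Union>G \<in> I" using fin sub by blast
  ultimately have "\<Union>G \<union> (B - \<Union>G) \<in> I" by (rule un)
  moreover have "B \<subseteq> \<Union>G \<union> (B - \<Union>G)" by blast
  ultimately show "B \<in> I" using I unfolding ideal_of_sets_def by blast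
qed

lemma id_plus_pos: "B \<in> id_plus \<A> \<Longrightarrow> pos \<A> B"
  unfolding id_plus_def pos_def using mem_id_gen by blast

lemma saturated_MADI:
  assumes inf: "infinite \<A>" "\<And>a. a \<in> \<A> \<Longrightarrow> infinite a" and ad: "ad \<A>"
    and sat: "\<And>B. pos \<A> B \<Longrightarrow> \<exists>a\<in>\<A>. a \<subseteq> B"
  shows "saturated_MAD \<A>"
proof -
  have AD: "AD \<A>" using inf ad unfolding AD_def ad_def inf_sets_def by blast
  have "\<B> = \<A>" if \<B>: "AD \<B>" "\<A> \<subseteq> \<B>" for \<B>
  proof (rule ccontr)
    assume "\<B> \<noteq> \<A>"
    then obtain b where b: "b \<in> \<B>" "b \<notin> \<A>" using \<B>(2) by blast
    have pw: "pairwise (\<lambda>A B. finite (A \<inter> B)) \<B>" and "infinite b"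
      using \<B>(1) b(1) unfolding AD_def inf_sets_def by auto
    have fin: "finite (a \<inter> b)" if "a \<in> \<A>" for a
    proof -
      have "a \<noteq> b" "a \<in> \<B>" using that b(2) \<B>(2) by auto
      then show ?thesis using pairwiseD[OF pw _ b(1)] by simp
    qed
    then have "pos \<A> b" using pos_if_orthogonal[OF \<open>infinite b\<close>] by simp
    then obtain a where a: "a \<in> \<A>" "a \<subseteq> b" using sat by blast
    then have "a \<inter> b = a" by blast
    then show False using fin[OF a(1)] inf(2)[OF a(1)] by simp
  qed
  then have "MAD \<A>" using AD unfolding MAD_def by blast
  moreover have "\<exists>A\<in>\<A>. A \<subseteq>* B" if B: "B \<in> id_plus \<A>" for B
  proof -
    obtain a where a: "a \<in> \<A>" "a \<subseteq> B" using sat[OF id_plus_pos[OF B]] by blast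
    from a(2) have "a - B = {}" by blast
    then show ?thesis using a(1) unfolding almost_subset_def by (metis finite.emptyI)
  qed
  ultimately show ?thesis unfolding saturated_MAD_def by blast
qed

text \<open>
  Recursion alone does not make the family infinite: nothing prevents the first set from being
  cofinite.  Choosing all sets thin with respect to a partition of \<open>\<omega>\<close> into infinitely many
  infinite columns excludes this, as finitely many thin sets never almost cover all columns.
\<close>

definition column :: "nat \<Rightarrow> nat set" where
  "column n = {m. fst (prod_decode m) = n}"

lemma infinite_column: "infinite (column n)"
proof -
  have "range (\<lambda>k. prod_encode (n, k)) \<subseteq> column n" unfolding column_def by auto
  moreover have "inj (\<lambda>k. prod_encode (n, k))" by (auto intro!: injI simp: prod_encode_eq)
  ultimately show ?thesis using range_inj_infinite finite_subset by blast
qed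

definition thin :: "nat set \<Rightarrow> bool" where
  "thin a \<longleftrightarrow> (\<exists>n. a \<subseteq> column n) \<or> (\<forall>n. finite (a \<inter> column n))"

lemma ex_thin_subset:
  assumes J: "dense_family J" and B: "infinite B"
  shows "\<exists>a\<in>{a \<in> J. thin a}. infinite a \<and> a \<subseteq> B"
proof -
  have D: "\<exists>a\<in>J. infinite a \<and> a \<subseteq> C" if "infinite C" for C
    using J that unfolding dense_family_def inf_sets_def by blast
  show ?thesis
  proof (cases "\<exists>n. infinite (B \<inter> column n)")
    case True
    then obtain n where n: "infinite (B \<inter> column n)" by blast
    obtain a where a: "a \<in> J" "infinite a" "a \<subseteq> B \<inter> column n" using D[OF n] by blast
    then have "thin a" unfolding thin_def by blast
    then show ?thesis using a by blast
  next
    case False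
    obtain a where a: "a \<in> J" "infinite a" "a \<subseteq> B" using D[OF B] by blast
    have "finite (a \<inter> column n)" for n
    proof -
      have "finite (B \<inter> column n)" using False by blast
      then show ?thesis by (rule rev_finite_subset) (use a(3) in blast)
    qed
    then have "thin a" unfolding thin_def by blast
    then show ?thesis using a by blast
  qed
qed

lemma infinite_thin_family:
  assumes thin: "\<And>a. a \<in> \<A> \<Longrightarrow> thin a \<and> infinite a"
    and sat: "\<And>B. pos \<A> B \<Longrightarrow> \<exists>a\<in>\<A>. a \<subseteq> B"
  shows "infinite \<A>"
proof
  assume fin: "finite \<A>"
  define c where "c a = fst (prod_decode (LEAST m. m \<in> a))" for a
  have c: "n = c a" if "a \<in> \<A>" "a \<subseteq> column n" for a n
  proof -
    have "\<exists>m. m \<in> a" using thin[OF that(1)] by (metis finite.emptyI ex_in_conv)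
    then have "(LEAST m. m \<in> a) \<in> a" by (rule LeastI_ex)
    then have "(LEAST m. m \<in> a) \<in> column n" using that(2) by blast
    then show ?thesis unfolding c_def column_def by simp
  qed
  obtain n where n: "n \<notin> c ` \<A>" using ex_new_if_finite[OF infinite_UNIV_nat finite_imageI[OF fin]] by blast
  have orth: "finite (a \<inter> column n)" if a: "a \<in> \<A>" for a
  proof (cases "\<exists>k. a \<subseteq> column k")
    case True
    then obtain k where k: "a \<subseteq> column k" by blast
    then have "k \<noteq> n" using c[OF a] a n by blast
    then have "a \<inter> column n = {}" using k unfolding column_def by auto
    then show ?thesis by simp
  next
    case False
    then show ?thesis using thin[OF a] unfolding thin_def by blast
  qed
  then have "pos \<A> (column n)" using pos_if_orthogonal[OF infinite_column] by simp
  then obtain a where a: "a \<in> \<A>" "a \<subseteq> column n" using sat by blast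
  then have "a \<inter> column n = a" by blast
  then show False using orth[OF a(1)] thin[OF a(1)] by simp
qed

text \<open>
  The levels are the subsets of \<open>\<omega>\<close> themselves, so that the identity enumerates the sets to be tested
  for membership.
\<close>

lemma ex_saturated_subfamily:
  assumes c: "is_aleph n k" "|UNIV :: nat set set| \<le>o k" and J: "dense_family J"
  shows "\<exists>\<A>. saturated_MAD \<A> \<and> \<A> \<subseteq> J"
proof -
  have unc: "uncountable (UNIV :: nat set set)"
  proof
    assume "countable (UNIV :: nat set set)"
    then have "|UNIV :: nat set set| \<le>o |UNIV :: nat set|"
      unfolding countable_def card_of_ordLeq[symmetric] by simp
    moreover have "|UNIV :: nat set| <o |UNIV :: nat set set|"
      using card_of_Pow[of "UNIV :: nat set"] by simp
    ultimately show False using not_ordLess_ordLeq by blast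
  qed
  obtain R :: "nat set rel" and u g where "strict_wo UNIV R \<and> guesses UNIV R u g \<and>
    (uncountable (UNIV :: nat set set) \<longrightarrow>
      (\<forall>D\<subseteq>UNIV. countable D \<longrightarrow> (\<exists>\<beta>\<in>UNIV. \<forall>d\<in>D. (d, \<beta>) \<in> R)))"
    using ex_guesses[OF c] by (elim exE)
  then have wo: "strict_wo UNIV R" and gs: "guesses UNIV R u g"
    and bd: "\<And>D. countable D \<Longrightarrow> \<exists>\<beta>. \<forall>d\<in>D. (d, \<beta>) \<in> R" using unc by simp_all
  have wf: "wf R" using wo unfolding strict_wo_def by blast
  interpret guessing_levels "\<lambda>\<alpha> \<beta>. \<alpha> = \<beta> \<or> (\<alpha>, \<beta>) \<in> R" "\<lambda>\<alpha> \<beta>. (\<alpha>, \<beta>) \<in> R" id u g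
  proof
    fix \<alpha> \<beta> \<gamma> :: "nat set"
    show "(\<alpha>, \<beta>) \<in> R \<longleftrightarrow> (\<alpha> = \<beta> \<or> (\<alpha>, \<beta>) \<in> R) \<and> \<not> (\<beta> = \<alpha> \<or> (\<beta>, \<alpha>) \<in> R)"
      using strict_wo_irrefl[OF wo] strict_wo_trans[OF wo] by blast
    show "\<alpha> = \<alpha> \<or> (\<alpha>, \<alpha>) \<in> R" by simp
    show "\<alpha> = \<gamma> \<or> (\<alpha>, \<gamma>) \<in> R" if "\<alpha> = \<beta> \<or> (\<alpha>, \<beta>) \<in> R" "\<beta> = \<gamma> \<or> (\<beta>, \<gamma>) \<in> R"
      using that strict_wo_trans[OF wo] by blast
    show "\<alpha> = \<beta>" if "\<alpha> = \<beta> \<or> (\<alpha>, \<beta>) \<in> R" "\<beta> = \<alpha> \<or> (\<beta>, \<alpha>) \<in> R"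
      using that strict_wo_irrefl[OF wo] strict_wo_trans[OF wo] by blast
    show "(\<alpha> = \<beta> \<or> (\<alpha>, \<beta>) \<in> R) \<or> (\<beta> = \<alpha> \<or> (\<beta>, \<alpha>) \<in> R)"
      using strict_wo_total[OF wo, of \<alpha> \<beta>] by auto
    show "P \<alpha>" if "\<And>\<alpha>. (\<And>\<beta>. (\<beta>, \<alpha>) \<in> R \<Longrightarrow> P \<beta>) \<Longrightarrow> P \<alpha>" for P
      using wf that by (rule wf_induct_rule)
    show "surj (id :: nat set \<Rightarrow> nat set)" by simp
    have ug: "countable (u \<alpha>) \<and> u \<alpha> \<subseteq> {\<beta>. (\<beta>, \<alpha>) \<in> R} \<and> mono (g \<alpha>)"
      using gs[unfolded guesses_def, THEN conjunct1] by simp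
    then show "countable (u \<alpha>)" by simp
    show "(\<beta>, \<alpha>) \<in> R" if "\<beta> \<in> u \<alpha>" using ug that by blast
    show "g \<alpha> m \<le> g \<alpha> n" if "m \<le> n" for m n using ug that by (blast dest: monoD)
    show "\<exists>\<beta>. \<forall>\<delta>\<in>D. (\<delta>, \<beta>) \<in> R" if "countable D" for D using bd[OF that] .
    show "\<exists>v. infinite (v \<inter> X) \<and> (\<forall>h. \<exists>\<alpha>. u \<alpha> = v \<and> (\<exists>\<beta>\<in>X. \<alpha> = \<beta> \<or> (\<alpha>, \<beta>) \<in> R) \<and>
        (\<exists>\<^sub>F n in sequentially. h n < g \<alpha> n))" if "\<not> less_b X" for X
      using gs[unfolded guesses_def, THEN conjunct2, rule_format, OF subset_UNIV that] by simp
  qed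
  have "\<exists>\<A>\<subseteq>{a \<in> J. thin a}. ad \<A> \<and> (\<forall>a\<in>\<A>. infinite a) \<and> (\<forall>B. pos \<A> B \<longrightarrow> (\<exists>a\<in>\<A>. a \<subseteq> B))"
    by (rule ex_ad_family) (rule ex_thin_subset[OF J])
  then obtain \<A> where \<A>: "\<A> \<subseteq> {a \<in> J. thin a}" "ad \<A>" "\<And>a. a \<in> \<A> \<Longrightarrow> infinite a"
      "\<And>B. pos \<A> B \<Longrightarrow> \<exists>a\<in>\<A>. a \<subseteq> B" by blast
  have "infinite \<A>" by (rule infinite_thin_family) (use \<A> in auto)
  then have "saturated_MAD \<A>" using \<A>(3,2,4) by (rule saturated_MADI)
  then show ?thesis using \<A>(1) by blast
qed

lemma card_of_continuum: "|UNIV :: nat set set| =o ctwo ^c natLeq"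
  using card_of_Pow_Func[of "UNIV :: nat set"]
  unfolding ctwo_def cexp_def Field_card_of Field_natLeq by simp

theorem mainTheorem1:
  shows "(less_aleph_omega (ctwo ^c natLeq) \<longrightarrow> (\<exists>\<A>. \<A> \<subseteq> inf_sets \<and> saturated_MAD \<A>)) \<and>
    (less_aleph_omega (ctwo ^c natLeq) \<longrightarrow>
      (\<forall>J. J \<subseteq> inf_sets \<and> dense_family J \<longrightarrow> (\<exists>\<A>. saturated_MAD \<A> \<and> \<A> \<subseteq> J)))"
proof -
  have main: "\<exists>\<A>. saturated_MAD \<A> \<and> \<A> \<subseteq> J"
    if c: "less_aleph_omega (ctwo ^c natLeq)" and J: "dense_family J" for J
  proof -
    obtain n and k :: "((nat \<Rightarrow> bool) + nat) set rel" where k: "is_aleph n k" "ctwo ^c natLeq <o k"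
      using c unfolding less_aleph_omega_def by blast
    have "|UNIV :: nat set set| \<le>o k"
      using card_of_continuum ordLess_imp_ordLeq[OF k(2)] by (rule ordIso_ordLeq_trans)
    then show ?thesis using ex_saturated_subfamily[OF k(1) _ J] by blast
  qed
  have "dense_family inf_sets" unfolding dense_family_def by blast
  then show ?thesis using main by blast
qed

end
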